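(* Let $F$ be a field of characteristic zero, $k\ge 2$, and let $L=\operatorname{Der}(M_k(F))$ be the Lie algebra of all derivations of $M_k(F)$, acting on $M_k(F)$. Then the variety $\operatorname{var}^L(M_k(F))$ of $L$-algebras generated by $M_k(F)$ has almost polynomial growth; that is, the sequence $c_n^L(M_k(F))$ is not polynomially bounded, but for every proper subvariety $\mathsf V$ of $\operatorname{var}^L(M_k(F))$ the sequence $c_n^L(\mathsf V)$ is polynomially bounded.
   Context: Algebras are associative, not necessarily unital. An $L$-algebra is an algebra $B$ with a Lie algebra homomorphism $L\to\operatorname{Der}(B)$; it extends to a unital algebra homomorphism $\phi_B:U(L)\to\operatorname{End}_F(B)$ from the universal enveloping algebra, and one writes $b^u:=\phi_B(u)(b)$. The class of $L$-algebras (for fixed $L$) is a variety in the sense of universal algebra. The free $L$-algebra $F\langle X|L\rangle$ on $X=\{x_1,x_2,\dots\}$ is the (nonunital) associative algebra generated by symbols $x_i^u$ ($i\ge1$, $u\in U(L)$) that are linear in $u$, with $x_i^1=x_i$; it is free on $\{x_i^e\}$ for $e$ in a basis of $U(L)$. $\operatorname{Id}^L(B)$ is the set of $f\in F\langle X|L\rangle$ vanishing under every substitution $x_i\mapsto b_i\in B$ (with $x_i^u\mapsto b_i^u$). $\operatorname{var}^L(B)$ is the class of all $L$-algebras $C$ with $\operatorname{Id}^L(B)\subseteq\operatorname{Id}^L(C)$. A subvariety is a class of the form $\mathsf V=\operatorname{var}^L(C)$ with $C\in\operatorname{var}^L(B)$; it is proper if it is not equal to $\operatorname{var}^L(B)$.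 $P_n^L$ is the span of the multilinear elements $x_{\sigma(1)}^{u_1}\cdots x_{\sigma(n)}^{u_n}$, $\sigma\in S_n$, $u_i\in U(L)$, and $c_n^L(\mathsf V)=c_n^L(C):=\dim_F P_n^L/(P_n^L\cap\operatorname{Id}^L(C))$ for any $C$ generating $\mathsf V$. A sequence $c_n$ is polynomially bounded if there exist $\alpha,t>0$ with $c_n\le\alpha n^t$ for all $n\ge1$. *)

theory Defs
  imports
    "HOL-Analysis.Cartesian_Space"
    "HOL-Combinatorics.Permutations"
    "HOL-Library.Poly_Mapping"
    "HOL-Library.Extended_Nat"
begin

section \<open>Associative algebras and derivations\<close>

text \<open>An algebra is a whole type with scalar multiplication and product passed explicitly;
  the product need not have a unit.\<close>

locale assoc_algebra = vector_space scl
  for scl :: "'f::field \<Rightarrow> 'b::ab_group_add \<Rightarrow> 'b" +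
  fixes mul :: "'b \<Rightarrow> 'b \<Rightarrow> 'b"
  assumes mult_add_left: "mul (a + b) c = mul a c + mul b c"
    and mult_add_right: "mul a (b + c) = mul a b + mul a c"
    and mult_scale_left: "mul (scl r a) b = scl r (mul a b)"
    and mult_scale_right: "mul a (scl r b) = scl r (mul a b)"
    and mult_assoc: "mul (mul a b) c = mul a (mul b c)"

definition is_derivation ::
    "('f::field \<Rightarrow> 'b::ab_group_add \<Rightarrow> 'b) \<Rightarrow> ('b \<Rightarrow> 'b \<Rightarrow> 'b) \<Rightarrow> ('b \<Rightarrow> 'b) \<Rightarrow> bool" where
  "is_derivation scl mul d \<longleftrightarrow>
     Vector_Spaces.linear scl scl d \<and>
     (\<forall>a b. d (mul a b) = mul (d a) b + mul a (d b))"

section \<open>The Lie algebra of derivations of a matrix algebra\<close>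

definition mat_scale :: "'f::field \<Rightarrow> 'f^'n^'n \<Rightarrow> 'f^'n^'n" where
  "mat_scale c A = (\<chi> i j. c * A $ i $ j)"

lemma assoc_algebra_mat:
  "assoc_algebra (mat_scale :: 'f::field \<Rightarrow> 'f^'n^'n \<Rightarrow> 'f^'n^'n) (**)"
proof (unfold_locales, goal_cases)
  case (9 a b c)
  show ?case by (simp add: matrix_mul_assoc)
qed (simp_all add: mat_scale_def vec_eq_iff matrix_matrix_mult_def algebra_simps sum.distrib
      sum_distrib_left sum_distrib_right)

lemma linear_iff_over:
  "Vector_Spaces.linear (s :: 'f::field \<Rightarrow> 'b::ab_group_add \<Rightarrow> 'b) s d \<longleftrightarrow>
     vector_space s \<and> (\<forall>a b. d (a + b) = d a + d b) \<and> (\<forall>r a. d (s r a) = s r (d a))"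
  by (auto simp: Vector_Spaces.linear_def module_hom_def module_hom_axioms_def
      vector_space_def module_def)

lemma is_derivation_mat_iff:
  "is_derivation mat_scale (**) (d :: 'f::field^'n^'n \<Rightarrow> 'f^'n^'n) \<longleftrightarrow>
     (\<forall>a b. d (a + b) = d a + d b) \<and> (\<forall>r a. d (mat_scale r a) = mat_scale r (d a)) \<and>
     (\<forall>a b. d (a ** b) = d a ** b + a ** d b)"
proof -
  interpret assoc_algebra "mat_scale :: 'f \<Rightarrow> 'f^'n^'n \<Rightarrow> 'f^'n^'n" "(**)"
    by (rule assoc_algebra_mat)
  show ?thesis
    using vector_space_axioms by (auto simp: is_derivation_def linear_iff_over)
qed

typedef (overloaded) ('f::field, 'n::finite) der =
  "{d :: 'f^'n^'n \<Rightarrow> 'f^'n^'n. is_derivation mat_scale (**) d}"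
proof
  interpret assoc_algebra "mat_scale :: 'f \<Rightarrow> 'f^'n^'n \<Rightarrow> 'f^'n^'n" "(**)"
    by (rule assoc_algebra_mat)
  show "(\<lambda>_. 0) \<in> {d :: 'f^'n^'n \<Rightarrow> 'f^'n^'n. is_derivation mat_scale (**) d}"
    using mult_add_left[of 0 0] mult_add_right[of _ 0 0] by (simp add: is_derivation_mat_iff)
qed

setup_lifting type_definition_der

lemma mat_algebra_simps:
  fixes A B C D :: "'f::field^'n^'n"
  shows "(A + B) ** C = A ** C + B ** C" "C ** (A + B) = C ** A + C ** B"
    "(A - B) ** C = A ** C - B ** C" "C ** (A - B) = C ** A - C ** B"
    "(- A) ** C = - (A ** C)" "C ** (- A) = - (C ** A)"
    "mat_scale r A ** C = mat_scale r (A ** C)" "C ** mat_scale r A = mat_scale r (C ** A)"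
    "mat_scale r (A + B) = mat_scale r A + mat_scale r B"
    "mat_scale r (A - B) = mat_scale r A - mat_scale r B"
    "mat_scale r (- A) = - mat_scale r A" "mat_scale r 0 = 0"
    "mat_scale r (mat_scale s A) = mat_scale (r * s) A"
    "mat_scale (r + s) A = mat_scale r A + mat_scale s A"
  by (simp_all add: mat_scale_def vec_eq_iff matrix_matrix_mult_def algebra_simps sum.distrib
      sum_subtractf sum_negf sum_distrib_left sum_distrib_right)

instantiation der :: (field, finite) ab_group_add
begin

lift_definition zero_der :: "('a, 'b) der" is "\<lambda>_. 0"
  by (simp add: is_derivation_mat_iff mat_algebra_simps)

lift_definition plus_der :: "('a, 'b) der \<Rightarrow> ('a, 'b) der \<Rightarrow> ('a, 'b) der" is "\<lambda>d e a. d a + e a"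
  by (simp add: is_derivation_mat_iff mat_algebra_simps algebra_simps)

lift_definition uminus_der :: "('a, 'b) der \<Rightarrow> ('a, 'b) der" is "\<lambda>d a. - d a"
  by (simp add: is_derivation_mat_iff mat_algebra_simps algebra_simps)

lift_definition minus_der :: "('a, 'b) der \<Rightarrow> ('a, 'b) der \<Rightarrow> ('a, 'b) der" is "\<lambda>d e a. d a - e a"
  by (simp add: is_derivation_mat_iff mat_algebra_simps algebra_simps)

instance
  by standard (transfer, simp add: algebra_simps)+

end

lift_definition der_scale :: "'f::field \<Rightarrow> ('f, 'n::finite) der \<Rightarrow> ('f, 'n) der"
  is "\<lambda>r d a. mat_scale r (d a)"
  by (simp add: is_derivation_mat_iff mat_algebra_simps mult.commute)

lift_definition der_bracket :: "('f::field, 'n::finite) der \<Rightarrow> ('f, 'n) der \<Rightarrow> ('f, 'n) der"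
  is "\<lambda>d e a. d (e a) - e (d a)"
  by (simp add: is_derivation_mat_iff mat_algebra_simps algebra_simps)

lifting_update der.lifting
lifting_forget der.lifting

section \<open>Free associative algebras and ideals\<close>

text \<open>The wrapper makes lists a monoid, so that \<open>'x fword \<Rightarrow>\<^sub>0 'f\<close>, the monoid algebra
  of the free monoid, is the free unital associative algebra on \<open>'x\<close>, with the product
  provided by the library.\<close>

datatype 'x fword = Word (letters: "'x list")

instantiation fword :: (type) monoid_add
begin

definition zero_fword :: "'a fword" where
  "zero_fword = Word []"

definition plus_fword :: "'a fword \<Rightarrow> 'a fword \<Rightarrow> 'a fword" where
  "plus_fword v w = Word (letters v @ letters w)"

instance
  by standard (simp_all add: zero_fword_def plus_fword_def)

end

lemma zero_fword_eq_plus_iff: "0 = v + w \<longleftrightarrow> v = 0 \<and> w = (0 :: 'a fword)"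
  by (cases v; cases w) (auto simp: zero_fword_def plus_fword_def)

definition fa_gen :: "'x \<Rightarrow> ('x fword \<Rightarrow>\<^sub>0 'f::field)" where
  "fa_gen x = Poly_Mapping.single (Word [x]) 1"

definition fa_scale :: "'f::field \<Rightarrow> ('x fword \<Rightarrow>\<^sub>0 'f) \<Rightarrow> ('x fword \<Rightarrow>\<^sub>0 'f)" where
  "fa_scale c p = Poly_Mapping.single 0 c * p"

lemma lookup_zero_times:
  fixes p q :: "'x fword \<Rightarrow>\<^sub>0 'f::field"
  assumes "Poly_Mapping.lookup p 0 = 0 \<or> Poly_Mapping.lookup q 0 = 0"
  shows "Poly_Mapping.lookup (p * q) 0 = 0"
proof (rule ccontr)
  assume "Poly_Mapping.lookup (p * q) 0 \<noteq> 0"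
  then have "0 \<in> Poly_Mapping.keys (p * q)"
    by (simp add: in_keys_iff)
  then obtain v w where "v \<in> Poly_Mapping.keys p" "w \<in> Poly_Mapping.keys q" "0 = v + w"
    using keys_mult[of p q] by blast
  then show False
    using assms by (simp add: zero_fword_eq_plus_iff in_keys_iff)
qed

lemma lookup_zero_fa_gen: "Poly_Mapping.lookup (fa_gen x) 0 = 0"
  by (simp add: fa_gen_def lookup_single zero_fword_def)

lemma fa_induct [case_names single add]:
  fixes p :: "'x fword \<Rightarrow>\<^sub>0 'f::field"
  assumes single: "\<And>w c. P (Poly_Mapping.single w c)"
    and add: "\<And>p q. P p \<Longrightarrow> P q \<Longrightarrow> P (p + q)"
  shows "P p"
proof (induction "card (Poly_Mapping.keys p)" arbitrary: p)
  case 0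
  then have "p = 0"
    by simp
  then show ?case
    using single[of 0 0] by simp
next
  case (Suc n)
  then obtain w where w: "w \<in> Poly_Mapping.keys p"
    by fastforce
  define q where "q = p - Poly_Mapping.single w (Poly_Mapping.lookup p w)"
  have "Poly_Mapping.keys q = Poly_Mapping.keys p - {w}"
    by (auto simp: q_def in_keys_iff lookup_minus lookup_single when_def split: if_splits)
  then have "P q"
    using Suc w by simp
  then have "P (q + Poly_Mapping.single w (Poly_Mapping.lookup p w))"
    using single add by blast
  then show ?case
    by (simp add: q_def)
qed

lemma single_zero_central:
  fixes p :: "'x fword \<Rightarrow>\<^sub>0 'f::field"
  shows "p * Poly_Mapping.single 0 c = Poly_Mapping.single 0 c * p"
  by (induction p rule: fa_induct) (simp_all add: mult_single algebra_simps)

text \<open>A ring ideal of a free unital algebra is automatically stable under \<^const>\<open>fa_scale\<close>.\<close>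

definition two_sided_ideal :: "'r::ring_1 set \<Rightarrow> bool" where
  "two_sided_ideal I \<longleftrightarrow>
     0 \<in> I \<and> (\<forall>a\<in>I. \<forall>b\<in>I. a + b \<in> I) \<and> (\<forall>a\<in>I. \<forall>r. r * a \<in> I \<and> a * r \<in> I)"

lemma two_sided_ideal_hull: "two_sided_ideal (two_sided_ideal hull S)"
  unfolding hull_def two_sided_ideal_def by auto

lemma two_sided_ideal_uminus:
  assumes "two_sided_ideal I" "a \<in> I"
  shows "- a \<in> I"
  using assms unfolding two_sided_ideal_def by (metis mult_minus1)

lemma two_sided_ideal_diff:
  assumes "two_sided_ideal I" "a \<in> I" "b \<in> I"
  shows "a - b \<in> I"
  using assms two_sided_ideal_uminus[of I b] unfolding two_sided_ideal_def
  by (metis add_uminus_conv_diff)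

lemma two_sided_ideal_cong:
  assumes I: "two_sided_ideal I"
  shows "p - p \<in> I"
    and "p - q \<in> I \<Longrightarrow> q - p \<in> I"
    and "p - q \<in> I \<Longrightarrow> q - r \<in> I \<Longrightarrow> p - r \<in> I"
    and "p - p' \<in> I \<Longrightarrow> q - q' \<in> I \<Longrightarrow> (p + q) - (p' + q') \<in> I"
    and "p - p' \<in> I \<Longrightarrow> q - q' \<in> I \<Longrightarrow> (p - q) - (p' - q') \<in> I"
    and "p - p' \<in> I \<Longrightarrow> (- p) - (- p') \<in> I"
    and "p - p' \<in> I \<Longrightarrow> q - q' \<in> I \<Longrightarrow> p * q - p' * q' \<in> I"
proof -
  note D = two_sided_ideal_diff[OF I] two_sided_ideal_uminus[OF I]
  have A: "a + b \<in> I" if "a \<in> I" "b \<in> I" for a b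
    using I that by (auto simp: two_sided_ideal_def)
  have M: "r * a \<in> I" "a * r \<in> I" if "a \<in> I" for a r
    using I that by (auto simp: two_sided_ideal_def)
  show "p - p \<in> I"
    using I by (simp add: two_sided_ideal_def)
  show "q - p \<in> I" if "p - q \<in> I"
    using D(2)[OF that] by simp
  show "p - r \<in> I" if "p - q \<in> I" "q - r \<in> I"
    using A[OF that] by simp
  show "(p + q) - (p' + q') \<in> I" if "p - p' \<in> I" "q - q' \<in> I"
    using A[OF that] by (simp add: algebra_simps)
  show "(p - q) - (p' - q') \<in> I" if "p - p' \<in> I" "q - q' \<in> I"
    using D(1)[OF that] by (simp add: algebra_simps)
  show "(- p) - (- p') \<in> I" if "p - p' \<in> I"
    using D(2)[OF that] by (simp add: algebra_simps)
  show "p * q - p' * q' \<in> I" if "p - p' \<in> I" "q - q' \<in> I"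
    using A[OF M(2)[OF that(1), of q] M(1)[OF that(2), of p']] by (simp add: algebra_simps)
qed

section \<open>The universal enveloping algebra\<close>

text \<open>Imposing linearity on the free algebra over the underlying set of a Lie algebra gives its
  tensor algebra.\<close>

definition env_relations ::
    "('f::field \<Rightarrow> 'l::ab_group_add \<Rightarrow> 'l) \<Rightarrow> ('l \<Rightarrow> 'l \<Rightarrow> 'l) \<Rightarrow> ('l fword \<Rightarrow>\<^sub>0 'f) set" where
  "env_relations scl bracket =
     {fa_gen (x + y) - fa_gen x - fa_gen y | x y. True} \<union>
     {fa_gen (scl c x) - fa_scale c (fa_gen x) | c x. True} \<union>
     {fa_gen x * fa_gen y - fa_gen y * fa_gen x - fa_gen (bracket x y) | x y. True}"

definition env_ideal ::
    "('f::field \<Rightarrow> 'l::ab_group_add \<Rightarrow> 'l) \<Rightarrow> ('l \<Rightarrow> 'l \<Rightarrow> 'l) \<Rightarrow> ('l fword \<Rightarrow>\<^sub>0 'f) set" where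
  "env_ideal scl bracket = two_sided_ideal hull (env_relations scl bracket)"

lemma two_sided_ideal_env_ideal: "two_sided_ideal (env_ideal scl bracket)"
  unfolding env_ideal_def by (rule two_sided_ideal_hull)

lemma zero_in_env_ideal [simp]: "0 \<in> env_ideal scl bracket"
  using two_sided_ideal_env_ideal by (auto simp: two_sided_ideal_def)

lemmas env_ideal_cong = two_sided_ideal_cong[OF two_sided_ideal_env_ideal]

lemma lookup_zero_env_ideal:
  assumes "p \<in> env_ideal scl bracket"
  shows "Poly_Mapping.lookup p 0 = 0"
proof -
  have "env_ideal scl bracket \<subseteq> {p. Poly_Mapping.lookup p 0 = 0}"
    unfolding env_ideal_def
  proof (rule hull_minimal)
    show "env_relations scl bracket \<subseteq> {p. Poly_Mapping.lookup p 0 = 0}"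
      by (auto simp: env_relations_def fa_scale_def lookup_minus lookup_zero_times
          lookup_zero_fa_gen)
    show "two_sided_ideal {p :: 'a fword \<Rightarrow>\<^sub>0 'b. Poly_Mapping.lookup p 0 = 0}"
      by (auto simp: two_sided_ideal_def lookup_add lookup_zero_times)
  qed
  then show ?thesis
    using assms by blast
qed

definition env_eq ::
    "(('f::field, 'n::finite) der fword \<Rightarrow>\<^sub>0 'f) \<Rightarrow> (('f, 'n) der fword \<Rightarrow>\<^sub>0 'f) \<Rightarrow> bool" where
  "env_eq p q \<longleftrightarrow> p - q \<in> env_ideal der_scale der_bracket"

quotient_type (overloaded) ('f, 'n) env = "('f::field, 'n::finite) der fword \<Rightarrow>\<^sub>0 'f" / env_eq
  morphisms rep_env abs_env
  unfolding env_eq_def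
  by (intro equivpI reflpI sympI transpI) (blast intro: env_ideal_cong)+

instantiation env :: (field, finite) ring_1
begin

lift_definition zero_env :: "('a, 'b) env" is 0 .
lift_definition one_env :: "('a, 'b) env" is 1 .
lift_definition plus_env :: "('a, 'b) env \<Rightarrow> ('a, 'b) env \<Rightarrow> ('a, 'b) env" is "(+)"
  unfolding env_eq_def by (rule env_ideal_cong)
lift_definition minus_env :: "('a, 'b) env \<Rightarrow> ('a, 'b) env \<Rightarrow> ('a, 'b) env" is "(-)"
  unfolding env_eq_def by (rule env_ideal_cong)
lift_definition uminus_env :: "('a, 'b) env \<Rightarrow> ('a, 'b) env" is uminus
  unfolding env_eq_def by (rule env_ideal_cong)
lift_definition times_env :: "('a, 'b) env \<Rightarrow> ('a, 'b) env \<Rightarrow> ('a, 'b) env" is "(*)"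
  unfolding env_eq_def by (rule env_ideal_cong)

instance
proof
  fix a b c :: "('a, 'b) env"
  show "a + b + c = a + (b + c)" by transfer (simp add: env_eq_def add.assoc)
  show "a + b = b + a" by transfer (simp add: env_eq_def add.commute)
  show "0 + a = a" by transfer (simp add: env_eq_def)
  show "- a + a = 0" by transfer (simp add: env_eq_def)
  show "a - b = a + - b" by transfer (simp add: env_eq_def)
  show "a * b * c = a * (b * c)" by transfer (simp add: env_eq_def mult.assoc)
  show "1 * a = a" by transfer (simp add: env_eq_def)
  show "a * 1 = a" by transfer (simp add: env_eq_def)
  show "(a + b) * c = a * c + b * c"
    by transfer (simp add: env_eq_def distrib_right)
  show "a * (b + c) = a * b + a * c"
    by transfer (simp add: env_eq_def distrib_left)
  show "(0 :: ('a, 'b) env) \<noteq> 1"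
    by transfer (auto simp: env_eq_def lookup_one dest: lookup_zero_env_ideal)
qed

end

lift_definition env_scale :: "'f::field \<Rightarrow> ('f, 'n::finite) env \<Rightarrow> ('f, 'n) env" is fa_scale
  unfolding env_eq_def fa_scale_def by (rule env_ideal_cong(7)[OF env_ideal_cong(1)])

lift_definition env_inj :: "('f::field, 'n::finite) der \<Rightarrow> ('f, 'n) env" is fa_gen .

lemma env_inj_relations:
  "env_inj (x + y) = env_inj x + env_inj y"
  "env_inj (der_scale c x) = env_scale c (env_inj x)"
  "env_inj (der_bracket x y) = env_inj x * env_inj y - env_inj y * env_inj x"
proof -
  have "r \<in> env_ideal der_scale der_bracket" if "r \<in> env_relations der_scale der_bracket"
    for r :: "('a, 'b) der fword \<Rightarrow>\<^sub>0 'a"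
    unfolding env_ideal_def using that by (rule hull_inc)
  note rel = this[unfolded env_relations_def]
  show "env_inj (x + y) = env_inj x + env_inj y"
    by transfer (auto simp: env_eq_def diff_diff_eq[symmetric] intro!: rel)
  show "env_inj (der_scale c x) = env_scale c (env_inj x)"
    by transfer (auto simp: env_eq_def intro!: rel)
  show "env_inj (der_bracket x y) = env_inj x * env_inj y - env_inj y * env_inj x"
    by (rule sym, transfer) (auto simp: env_eq_def intro!: rel)
qed

lifting_update env.lifting
lifting_forget env.lifting

section \<open>The free \<open>L\<close>-algebra\<close>

text \<open>The generator \<open>(i, u)\<close> stands for \<open>x\<^sub>i\<^sup>u\<close>, with variables indexed from \<open>0\<close>.\<close>

definition free_relations :: "((nat \<times> ('f::field, 'n::finite) env) fword \<Rightarrow>\<^sub>0 'f) set" where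
  "free_relations =
     {fa_gen (i, u + v) - fa_gen (i, u) - fa_gen (i, v) | i u v. True} \<union>
     {fa_gen (i, env_scale c u) - fa_scale c (fa_gen (i, u)) | i c u. True}"

definition free_ideal :: "((nat \<times> ('f::field, 'n::finite) env) fword \<Rightarrow>\<^sub>0 'f) set" where
  "free_ideal = two_sided_ideal hull free_relations"

lemma two_sided_ideal_free_ideal: "two_sided_ideal free_ideal"
  unfolding free_ideal_def by (rule two_sided_ideal_hull)

lemma zero_in_free_ideal [simp]: "0 \<in> free_ideal"
  using two_sided_ideal_free_ideal by (auto simp: two_sided_ideal_def)

lemmas free_ideal_cong = two_sided_ideal_cong[OF two_sided_ideal_free_ideal]

text \<open>The quotient is taken on the elements without constant term only, which yields the
  nonunital algebra.\<close>

definition free_eq ::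
    "((nat \<times> ('f::field, 'n::finite) env) fword \<Rightarrow>\<^sub>0 'f) \<Rightarrow>
     ((nat \<times> ('f, 'n) env) fword \<Rightarrow>\<^sub>0 'f) \<Rightarrow> bool" where
  "free_eq p q \<longleftrightarrow>
     Poly_Mapping.lookup p 0 = 0 \<and> Poly_Mapping.lookup q 0 = 0 \<and> p - q \<in> free_ideal"

quotient_type (overloaded) ('f, 'n) free_lalg =
    "(nat \<times> ('f::field, 'n::finite) env) fword \<Rightarrow>\<^sub>0 'f" / partial: free_eq
  morphisms rep_free abs_free
proof (rule part_equivpI)
  show "\<exists>p :: (nat \<times> ('f, 'n) env) fword \<Rightarrow>\<^sub>0 'f. free_eq p p"
    by (rule exI[of _ 0]) (simp add: free_eq_def)
  show "symp (free_eq :: _ \<Rightarrow> ((nat \<times> ('f, 'n) env) fword \<Rightarrow>\<^sub>0 'f) \<Rightarrow> bool)"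
    by (rule sympI) (auto simp: free_eq_def intro: free_ideal_cong(2))
  show "transp (free_eq :: _ \<Rightarrow> ((nat \<times> ('f, 'n) env) fword \<Rightarrow>\<^sub>0 'f) \<Rightarrow> bool)"
    by (rule transpI) (auto simp: free_eq_def intro: free_ideal_cong(3))
qed

instantiation free_lalg :: (field, finite) ring
begin

lift_definition zero_free_lalg :: "('a, 'b) free_lalg" is 0
  by (simp add: free_eq_def)
lift_definition plus_free_lalg :: "('a, 'b) free_lalg \<Rightarrow> ('a, 'b) free_lalg \<Rightarrow> ('a, 'b) free_lalg"
  is "(+)" unfolding free_eq_def by (simp add: lookup_add free_ideal_cong(4))
lift_definition minus_free_lalg :: "('a, 'b) free_lalg \<Rightarrow> ('a, 'b) free_lalg \<Rightarrow> ('a, 'b) free_lalg"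
  is "(-)" unfolding free_eq_def by (simp add: lookup_minus free_ideal_cong(5))
lift_definition uminus_free_lalg :: "('a, 'b) free_lalg \<Rightarrow> ('a, 'b) free_lalg"
  is uminus by (simp add: free_eq_def free_ideal_cong(2))
lift_definition times_free_lalg :: "('a, 'b) free_lalg \<Rightarrow> ('a, 'b) free_lalg \<Rightarrow> ('a, 'b) free_lalg"
  is "(*)" unfolding free_eq_def by (simp add: lookup_zero_times free_ideal_cong(7))

lemmas free_lalg_simps = free_eq_def lookup_add lookup_minus lookup_zero_times

instance
proof
  fix a b c :: "('a, 'b) free_lalg"
  show "a + b + c = a + (b + c)"
    by transfer (simp add: free_lalg_simps add.assoc)
  show "a + b = b + a" by transfer (simp add: free_lalg_simps add.commute)
  show "0 + a = a" by transfer (simp add: free_lalg_simps)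
  show "- a + a = 0" by transfer (simp add: free_lalg_simps)
  show "a - b = a + - b" by transfer (simp add: free_lalg_simps)
  show "a * b * c = a * (b * c)"
    by transfer (simp add: free_lalg_simps mult.assoc)
  show "(a + b) * c = a * c + b * c"
    by transfer (simp add: free_lalg_simps distrib_right)
  show "a * (b + c) = a * b + a * c"
    by transfer (simp add: free_lalg_simps distrib_left)
qed

end

lift_definition free_scale ::
    "'f::field \<Rightarrow> ('f, 'n::finite) free_lalg \<Rightarrow> ('f, 'n) free_lalg" is fa_scale
  unfolding free_eq_def fa_scale_def
  by (simp add: lookup_zero_times free_ideal_cong(7)[OF free_ideal_cong(1)])

text \<open>The monomial \<open>x\<^sub>i\<^sup>u \<cdots> x\<^sub>j\<^sup>v\<close>. The empty list is not a monomial of a nonunital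
  algebra; it is sent to \<open>0\<close>.\<close>

lift_definition free_monom ::
    "(nat \<times> ('f::field, 'n::finite) env) list \<Rightarrow> ('f, 'n) free_lalg"
  is "\<lambda>ws. if ws = [] then 0 else Poly_Mapping.single (Word ws) 1"
  by (simp add: free_eq_def lookup_single zero_fword_def)

lemma free_monom_append:
  assumes "ws \<noteq> []" "vs \<noteq> []"
  shows "free_monom (ws @ vs) = free_monom ws * free_monom vs"
  using assms
  by transfer (simp add: free_eq_def mult_single
      plus_fword_def lookup_single zero_fword_def)

lemma assoc_algebra_free: "assoc_algebra free_scale (*)"
proof (unfold_locales, goal_cases)
  case (1 a x y)
  show ?case
    by transfer (simp add: free_lalg_simps fa_scale_def distrib_left)
next
  case (2 a b x)
  show ?case
    by transfer (simp add: free_lalg_simps fa_scale_def distrib_right single_add)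
next
  case (3 a b x)
  show ?case
    by transfer
      (simp add: free_lalg_simps fa_scale_def mult_single flip: mult.assoc)
next
  case (4 x)
  show ?case
    by transfer (simp add: free_lalg_simps fa_scale_def)
next
  case (7 r a b)
  show ?case
    by transfer (simp add: free_lalg_simps fa_scale_def mult.assoc)
next
  case (8 a r b)
  show ?case
proof transfer
    fix a b :: "(nat \<times> ('a, 'b) env) fword \<Rightarrow>\<^sub>0 'a" and r
    assume "free_eq a a" "free_eq b b"
    moreover have "a * fa_scale r b = fa_scale r (a * b)"
      unfolding fa_scale_def by (metis mult.assoc single_zero_central)
    ultimately show "free_eq (a * fa_scale r b) (fa_scale r (a * b))"
      by (simp add: free_lalg_simps fa_scale_def)
  qed
qed (simp_all add: algebra_simps)

section \<open>\<open>L\<close>-algebras and their identities\<close>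

record ('f, 'l, 'b) lalg =
  lalg_scale :: "'f \<Rightarrow> 'b \<Rightarrow> 'b"
  lalg_mult :: "'b \<Rightarrow> 'b \<Rightarrow> 'b"
  lalg_act :: "'l \<Rightarrow> 'b \<Rightarrow> 'b"

definition is_L_algebra ::
    "('f::field, ('f, 'n::finite) der, 'b::ab_group_add) lalg \<Rightarrow> bool" where
  "is_L_algebra A \<longleftrightarrow>
     assoc_algebra (lalg_scale A) (lalg_mult A) \<and>
     (\<forall>d. is_derivation (lalg_scale A) (lalg_mult A) (lalg_act A d)) \<and>
     (\<forall>d e b. lalg_act A (d + e) b = lalg_act A d b + lalg_act A e b) \<and>
     (\<forall>c d b. lalg_act A (der_scale c d) b = lalg_scale A c (lalg_act A d b)) \<and>
     (\<forall>d e b. lalg_act A (der_bracket d e) b =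
        lalg_act A d (lalg_act A e b) - lalg_act A e (lalg_act A d b))"

definition mat_lalg :: "('f::field, ('f, 'n::finite) der, 'f^'n^'n) lalg" where
  "mat_lalg = \<lparr>lalg_scale = mat_scale, lalg_mult = (**), lalg_act = Rep_der\<rparr>"

lemma is_L_algebra_mat_lalg: "is_L_algebra mat_lalg"
  using Rep_der
  by (auto simp: is_L_algebra_def mat_lalg_def assoc_algebra_mat plus_der.rep_eq
      der_scale.rep_eq der_bracket.rep_eq)

definition fa_extend ::
    "('f::field \<Rightarrow> 'b \<Rightarrow> 'b::comm_monoid_add) \<Rightarrow> ('x fword \<Rightarrow> 'b) \<Rightarrow> ('x fword \<Rightarrow>\<^sub>0 'f) \<Rightarrow> 'b" where
  "fa_extend scl g p = (\<Sum>w\<in>Poly_Mapping.keys p. scl (Poly_Mapping.lookup p w) (g w))"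

text \<open>\<open>env_action A u b\<close> is \<open>b\<^sup>u\<close>: a word in derivations acts by composition. For an
  \<open>L\<close>-algebra, the chosen representative of \<open>u\<close> does not matter.\<close>

definition word_action ::
    "('f, 'l, 'b) lalg \<Rightarrow> 'l fword \<Rightarrow> 'b \<Rightarrow> 'b" where
  "word_action A w b = foldr (lalg_act A) (letters w) b"

definition env_action ::
    "('f::field, ('f, 'n::finite) der, 'b::ab_group_add) lalg \<Rightarrow> ('f, 'n) env \<Rightarrow> 'b \<Rightarrow> 'b" where
  "env_action A u b = fa_extend (lalg_scale A) (\<lambda>w. word_action A w b) (rep_env u)"

fun nonempty_prod :: "('b \<Rightarrow> 'b \<Rightarrow> 'b) \<Rightarrow> 'b::zero list \<Rightarrow> 'b" where
  "nonempty_prod mul [] = 0"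
| "nonempty_prod mul [a] = a"
| "nonempty_prod mul (a # b # bs) = mul a (nonempty_prod mul (b # bs))"

text \<open>\<open>free_eval A b f\<close> is the value of \<open>f\<close> under the substitution \<open>x\<^sub>i\<^sup>u \<mapsto> (b\<^sub>i)\<^sup>u\<close>;
  it is again independent of the representative when \<open>A\<close> is an \<open>L\<close>-algebra.\<close>

definition word_eval ::
    "('f::field, ('f, 'n::finite) der, 'b::ab_group_add) lalg \<Rightarrow> (nat \<Rightarrow> 'b) \<Rightarrow>
     (nat \<times> ('f, 'n) env) fword \<Rightarrow> 'b" where
  "word_eval A b w =
     nonempty_prod (lalg_mult A) (map (\<lambda>(i, u). env_action A u (b i)) (letters w))"

definition free_eval ::
    "('f::field, ('f, 'n::finite) der, 'b::ab_group_add) lalg \<Rightarrow> (nat \<Rightarrow> 'b) \<Rightarrow>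
     ('f, 'n) free_lalg \<Rightarrow> 'b" where
  "free_eval A b f = fa_extend (lalg_scale A) (word_eval A b) (rep_free f)"

lemma fa_extend_simps:
  assumes "vector_space scl"
  shows "fa_extend scl g 0 = 0"
    and "fa_extend scl g (p + q) = fa_extend scl g p + fa_extend scl g q"
    and "fa_extend scl g (- p) = - fa_extend scl g p"
    and "fa_extend scl g (p - q) = fa_extend scl g p - fa_extend scl g q"
    and "fa_extend scl g (Poly_Mapping.single w c) = scl c (g w)"
proof -
  interpret vector_space scl by fact
  show zero: "fa_extend scl g 0 = 0"
    by (simp add: fa_extend_def)
  have add: "fa_extend scl g (p + q) = fa_extend scl g p + fa_extend scl g q" for p q
    unfolding fa_extend_def
    by (rule setsum_keys_plus_distrib) (simp_all add: scale_left_distrib)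
  then show "fa_extend scl g (p + q) = fa_extend scl g p + fa_extend scl g q" .
  have "fa_extend scl g (- p) + fa_extend scl g p = 0" for p
    using add[of "- p" p] zero by simp
  then show neg: "fa_extend scl g (- p) = - fa_extend scl g p" for p
    by (simp add: eq_neg_iff_add_eq_0)
  show "fa_extend scl g (p - q) = fa_extend scl g p - fa_extend scl g q"
    using add[of p "- q"] neg[of q] by simp
  show "fa_extend scl g (Poly_Mapping.single w c) = scl c (g w)"
    by (cases "c = 0") (simp_all add: fa_extend_def)
qed

context
  fixes A :: "('f::field, ('f, 'n::finite) der, 'b::ab_group_add) lalg"
  assumes A: "is_L_algebra A"
begin

interpretation assoc_algebra "lalg_scale A" "lalg_mult A"
  using A by (simp add: is_L_algebra_def)

lemmas ext_simps = fa_extend_simps[OF vector_space_axioms]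

lemma act_simps:
  "lalg_act A d (a + b) = lalg_act A d a + lalg_act A d b"
  "lalg_act A d (lalg_scale A r b) = lalg_scale A r (lalg_act A d b)"
  "lalg_act A (d + e) b = lalg_act A d b + lalg_act A e b"
  "lalg_act A (der_scale r d) b = lalg_scale A r (lalg_act A d b)"
  "lalg_act A (der_bracket d e) b =
     lalg_act A d (lalg_act A e b) - lalg_act A e (lalg_act A d b)"
  using A by (simp_all add: is_L_algebra_def is_derivation_def linear_iff_over)

lemma word_action_simps:
  "word_action A w (a + b) = word_action A w a + word_action A w b"
  "word_action A w (lalg_scale A r b) = lalg_scale A r (word_action A w b)"
  "word_action A (v + w) b = word_action A v (word_action A w b)"
  "word_action A 0 b = b"
  "word_action A (Word [d]) b = lalg_act A d b"
proof -
  show "word_action A w (a + b) = word_action A w a + word_action A w b"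
    unfolding word_action_def by (rule list.induct[of _ "letters w"]) (simp_all add: act_simps)
  show "word_action A w (lalg_scale A r b) = lalg_scale A r (word_action A w b)"
    unfolding word_action_def by (rule list.induct[of _ "letters w"]) (simp_all add: act_simps)
qed (simp_all add: word_action_def plus_fword_def zero_fword_def)

abbreviation fa_action where
  "fa_action p b \<equiv> fa_extend (lalg_scale A) (\<lambda>w. word_action A w b) p"

lemma fa_action_simps:
  "fa_action p (a + b) = fa_action p a + fa_action p b"
  "fa_action p (lalg_scale A r b) = lalg_scale A r (fa_action p b)"
  "fa_action p 0 = 0"
  "fa_action (p * q) b = fa_action p (fa_action q b)"
proof -
  show add: "fa_action p (a + b) = fa_action p a + fa_action p b" for a b
    by (simp add: fa_extend_def word_action_simps scale_right_distrib sum.distrib)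
  show scale: "fa_action p (lalg_scale A r b) = lalg_scale A r (fa_action p b)" for r b
    by (simp add: fa_extend_def word_action_simps scale_sum_right mult.commute)
  show "fa_action p 0 = 0"
    using scale[of 0 0] by simp
  show "fa_action (p * q) b = fa_action p (fa_action q b)"
  proof (induction p rule: fa_induct)
    case (single w c)
    show ?case
      by (induction q rule: fa_induct)
        (simp_all add: ext_simps mult_single word_action_simps distrib_left scale_right_distrib)
  qed (simp add: ext_simps distrib_right)
qed

lemma fa_action_env_ideal:
  assumes "p \<in> env_ideal der_scale der_bracket"
  shows "fa_action p b = 0"
proof -
  have "env_ideal der_scale der_bracket \<subseteq> {p. \<forall>b. fa_action p b = 0}"
    unfolding env_ideal_def
  proof (rule hull_minimal)
    show "env_relations der_scale der_bracket \<subseteq> {p. \<forall>b. fa_action p b = 0}"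
      by (auto simp: env_relations_def ext_simps fa_gen_def fa_scale_def mult_single
          word_action_simps act_simps)
    show "two_sided_ideal {p. \<forall>b. fa_action p b = 0}"
      by (simp add: two_sided_ideal_def ext_simps fa_action_simps)
  qed
  then show ?thesis
    using assms by blast
qed

lemma env_action_abs: "env_action A (abs_env p) b = fa_action p b"
proof -
  have "env_eq (rep_env (abs_env p)) p"
    using Quotient3_rep_abs[OF Quotient3_env] env_eq_def env_ideal_cong(1) by metis
  then have "fa_action (rep_env (abs_env p) - p) b = 0"
    unfolding env_eq_def by (rule fa_action_env_ideal)
  then show ?thesis
    by (simp add: env_action_def ext_simps)
qed

lemma env_action_env_inj: "env_action A (env_inj d) b = lalg_act A d b"
  by (simp add: env_inj.abs_eq env_action_abs fa_gen_def ext_simps word_action_simps)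

lemma env_action_simps:
  "env_action A u (a + b) = env_action A u a + env_action A u b"
  "env_action A u (lalg_scale A r b) = lalg_scale A r (env_action A u b)"
  "env_action A (u + v) b = env_action A u b + env_action A v b"
  "env_action A (env_scale r u) b = lalg_scale A r (env_action A u b)"
  "env_action A (u * v) b = env_action A u (env_action A v b)"
  "env_action A 1 b = b"
proof -
  obtain p q where pq: "u = abs_env p" "v = abs_env q"
    by (metis Quotient3_env Quotient3_abs_rep)
  have scale: "env_scale r u = abs_env (fa_scale r p)"
    by (simp add: pq env_scale.abs_eq)
  show "env_action A (env_scale r u) b = lalg_scale A r (env_action A u b)"
    unfolding scale by (simp add: pq env_action_abs fa_action_simps fa_scale_def ext_simps
        word_action_simps)
  show "env_action A (u + v) b = env_action A u b + env_action A v b"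
    by (simp add: pq plus_env.abs_eq env_action_abs ext_simps)
  show "env_action A (u * v) b = env_action A u (env_action A v b)"
    by (simp add: pq times_env.abs_eq env_action_abs fa_action_simps)
  have "fa_action 1 b = b"
    by (simp add: ext_simps word_action_simps flip: single_one)
  then show "env_action A 1 b = b"
    by (simp add: one_env_def env_action_abs)
qed (simp_all add: env_action_def fa_action_simps)

lemma nonempty_prod_append:
  assumes "xs \<noteq> []" "ys \<noteq> []"
  shows "nonempty_prod (lalg_mult A) (xs @ ys) =
    lalg_mult A (nonempty_prod (lalg_mult A) xs) (nonempty_prod (lalg_mult A) ys)"
  using assms
proof (induction xs rule: induct_list012)
  case (2 x)
  then show ?case by (cases ys) simp_all
qed (simp_all add: mult_assoc)

abbreviation fa_eval where
  "fa_eval b p \<equiv> fa_extend (lalg_scale A) (word_eval A b) p"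

lemma mult_zero: "lalg_mult A 0 b = 0" "lalg_mult A a 0 = 0"
  using mult_add_left[of 0 0 b] mult_add_right[of a 0 0] by simp_all

lemma word_eval_plus:
  assumes "v \<noteq> 0" "w \<noteq> 0"
  shows "word_eval A b (v + w) = lalg_mult A (word_eval A b v) (word_eval A b w)"
  using assms by (cases v; cases w)
    (simp add: word_eval_def plus_fword_def zero_fword_def nonempty_prod_append)

lemma word_eval_zero: "word_eval A b 0 = 0"
  by (simp add: word_eval_def zero_fword_def)

lemma fa_eval_scale:
  "fa_eval b (Poly_Mapping.single 0 c * q) = lalg_scale A c (fa_eval b q)"
  by (induction q rule: fa_induct)
    (simp_all add: ext_simps mult_single distrib_left scale_right_distrib)

lemma fa_eval_single_mult:
  assumes "w \<noteq> 0"
  shows "fa_eval b (Poly_Mapping.single w c * q) = lalg_scale A c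
      (lalg_mult A (word_eval A b w) (fa_eval b q) +
       lalg_scale A (Poly_Mapping.lookup q 0) (word_eval A b w))" (is ?l)
    and "fa_eval b (q * Poly_Mapping.single w c) = lalg_scale A c
      (lalg_mult A (fa_eval b q) (word_eval A b w) +
       lalg_scale A (Poly_Mapping.lookup q 0) (word_eval A b w))" (is ?r)
proof -
  have *: "v + w \<noteq> 0 \<and> w + v \<noteq> 0" for v
    using zero_fword_eq_plus_iff assms by metis
  show ?l
  proof (induction q rule: fa_induct)
    case (single v d)
    show ?case
      using assms by (cases "v = 0") (simp_all add: ext_simps mult_single word_eval_plus
          word_eval_zero mult_zero lookup_single mult_scale_right)
  qed (simp add: ext_simps distrib_left scale_right_distrib scale_left_distrib lookup_add
        mult_add_right add_ac)
  show ?r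
  proof (induction q rule: fa_induct)
    case (single v d)
    show ?case
      using assms by (cases "v = 0") (simp_all add: ext_simps mult_single word_eval_plus
          word_eval_zero mult_zero lookup_single mult_scale_left mult.commute)
  qed (simp add: ext_simps distrib_right scale_right_distrib scale_left_distrib lookup_add
        mult_add_left add_ac)
qed

lemma fa_eval_mult:
  assumes "Poly_Mapping.lookup p 0 = 0" "Poly_Mapping.lookup q 0 = 0"
  shows "fa_eval b (p * q) = lalg_mult A (fa_eval b p) (fa_eval b q)"
proof -
  have "fa_eval b (p * q) = lalg_mult A (fa_eval b p) (fa_eval b q) +
      lalg_scale A (Poly_Mapping.lookup p 0) (fa_eval b q)"
  proof (induction p rule: fa_induct)
    case (single w c)
    show ?case
      using assms(2) by (cases "w = 0") (simp_all add: fa_eval_scale fa_eval_single_mult ext_simps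
          word_eval_zero mult_zero lookup_single mult_scale_left)
  qed (simp add: ext_simps distrib_right scale_left_distrib lookup_add mult_add_left add_ac)
  then show ?thesis
    using assms(1) by simp
qed

lemma fa_eval_free_ideal:
  assumes "p \<in> free_ideal"
  shows "Poly_Mapping.lookup p 0 = 0 \<and> fa_eval b p = 0"
proof -
  let ?I = "{p. Poly_Mapping.lookup p 0 = 0 \<and> fa_eval b p = 0}"
  have "r * p \<in> ?I \<and> p * r \<in> ?I" if "p \<in> ?I" for p r
  proof (induction r rule: fa_induct)
    case (single w c)
    show ?case
      using that by (cases "w = 0") (simp_all add: fa_eval_scale fa_eval_single_mult
          lookup_zero_times mult_zero single_zero_central)
  qed (simp add: distrib_left distrib_right ext_simps lookup_add)
  then have "two_sided_ideal ?I"
    unfolding two_sided_ideal_def by (simp add: ext_simps lookup_add)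
  moreover have "free_relations \<subseteq> ?I"
    by (auto simp: free_relations_def lookup_minus lookup_zero_fa_gen ext_simps fa_scale_def
        lookup_zero_times fa_eval_scale)
      (simp_all add: fa_gen_def ext_simps word_eval_def env_action_simps)
  ultimately have "free_ideal \<subseteq> ?I"
    unfolding free_ideal_def by (simp add: hull_minimal)
  then show ?thesis
    using assms by blast
qed

lemma free_eval_abs:
  assumes "Poly_Mapping.lookup p 0 = 0"
  shows "free_eval A b (abs_free p) = fa_eval b p"
proof -
  have "free_eq p p"
    using assms by (simp add: free_eq_def)
  then have "free_eq (rep_free (abs_free p)) p"
    using Quotient3_rep_abs[OF Quotient3_free_lalg] by blast
  then have "fa_eval b (rep_free (abs_free p) - p) = 0"
    using fa_eval_free_ideal unfolding free_eq_def by blast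
  then show ?thesis
    by (simp add: free_eval_def ext_simps)
qed

lemma free_eval_simps:
  "free_eval A b (f + g) = free_eval A b f + free_eval A b g"
  "free_eval A b (free_scale r f) = lalg_scale A r (free_eval A b f)"
  "free_eval A b (f * g) = lalg_mult A (free_eval A b f) (free_eval A b g)"
  "free_eval A b (free_monom [(i, u)]) = env_action A u (b i)"
proof -
  have rep: "free_eq (rep_free h) (rep_free h)" for h :: "('f, 'n) free_lalg"
    by (rule Quotient3_rep_reflp[OF Quotient3_free_lalg])
  obtain p q where pq: "f = abs_free p" "g = abs_free q" "free_eq p p" "free_eq q q"
    by (metis rep Quotient3_free_lalg Quotient3_abs_rep)
  note lk = this(3,4)[unfolded free_eq_def]
  show "free_eval A b (f + g) = free_eval A b f + free_eval A b g"
    using pq lk by (simp add: plus_free_lalg.abs_eq free_eval_abs lookup_add ext_simps)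
  show "free_eval A b (f * g) = lalg_mult A (free_eval A b f) (free_eval A b g)"
    using pq lk by (simp add: times_free_lalg.abs_eq free_eval_abs lookup_zero_times fa_eval_mult)
  show "free_eval A b (free_scale r f) = lalg_scale A r (free_eval A b f)"
    using pq lk by (simp add: free_scale.abs_eq free_eval_abs lookup_zero_times fa_scale_def
        fa_eval_scale)
  show "free_eval A b (free_monom [(i, u)]) = env_action A u (b i)"
    by (simp add: free_monom.abs_eq free_eval_abs lookup_single zero_fword_def ext_simps
        word_eval_def)
qed

end

definition L_identities ::
    "('f::field, ('f, 'n::finite) der, 'b::ab_group_add) lalg \<Rightarrow> ('f, 'n) free_lalg set" where
  "L_identities A = {f. \<forall>b. free_eval A b f = 0}"

text \<open>A class of algebras is a set at each underlying type \<open>'c\<close>, which is independent of the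
  type underlying \<open>A\<close>.\<close>

definition L_variety ::
    "('f::field, ('f, 'n::finite) der, 'b::ab_group_add) lalg \<Rightarrow>
     ('f, ('f, 'n) der, 'c::ab_group_add) lalg set" where
  "L_variety A = {C. is_L_algebra C \<and> L_identities A \<subseteq> L_identities C}"

section \<open>Codimensions\<close>

definition multilinear_part :: "nat \<Rightarrow> ('f::field, 'n::finite) free_lalg set" where
  "multilinear_part n = module.span free_scale
     {free_monom (map (\<lambda>j. (\<sigma> j, u j)) [0..<n]) | \<sigma> u. \<sigma> permutes {..<n}}"

text \<open>The dimension of \<open>P/Q\<close>, as the supremum of the sizes of the finite families in \<open>P\<close>
  that are linearly independent modulo \<open>Q\<close>; it is \<open>\<infinity>\<close> if \<open>P/Q\<close> has infinite dimension.\<close>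

definition quotient_dim ::
    "('f::field \<Rightarrow> 'v::ab_group_add \<Rightarrow> 'v) \<Rightarrow> 'v set \<Rightarrow> 'v set \<Rightarrow> enat" where
  "quotient_dim scl P Q =
     (SUP S \<in> {S. finite S \<and> S \<subseteq> P \<and>
                  (\<forall>a. (\<Sum>v\<in>S. scl (a v) v) \<in> Q \<longrightarrow> (\<forall>v\<in>S. a v = 0))}. enat (card S))"

definition L_codim ::
    "('f::field, ('f, 'n::finite) der, 'b::ab_group_add) lalg \<Rightarrow> nat \<Rightarrow> enat" where
  "L_codim A n = quotient_dim free_scale
     (multilinear_part n) (multilinear_part n \<inter> L_identities A)"

definition polynomially_bounded :: "(nat \<Rightarrow> enat) \<Rightarrow> bool" where
  "polynomially_bounded c \<longleftrightarrow>
     (\<exists>\<alpha> t :: real. \<alpha> > 0 \<and> t > 0 \<and>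
        (\<forall>n\<ge>1. \<exists>m. c n = enat m \<and> real m \<le> \<alpha> * real n powr t))"

end

theory Submission
  imports Defs "HOL-Real_Asymp.Real_Asymp"
begin

text \<open>
The matrix algebra is the sum of the scalar matrices and the traceless matrices, two
submodules that are absolutely irreducible and not isomorphic. The enveloping algebra of the
derivations therefore acts on it by all linear maps that preserve both summands. This is seen
here directly: the square of the commutator with \<open>E\<^sub>p\<^sub>q\<close> has rank one, and composing with
further commutators gives every \<open>x \<mapsto> \<eta>(x) d\<close> with \<open>\<eta>\<close> a traceless coordinate and \<open>d\<close>
traceless (\<open>tensor_env_map_coord\<close>), hence also the projection onto the scalar matrices
(\<open>tensor_env_map_trace\<close>).

The codimensions of the matrix algebra are at least \<open>2 ^ n\<close>, because each of the \<open>n\<close> variables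
can be projected to either summand independently (\<open>exponential_codim_mat\<close>).

Now let \<open>C\<close> generate a proper subvariety. The identities of the matrix algebra hold in \<open>C\<close>,
and \<open>C\<close> has an identity \<open>f\<close> with a nonzero value \<open>f(b)\<close> on matrices. One may therefore
compute with functions on matrices, modulo those represented by identities of \<open>C\<close>. The product of
two traceless coordinates of variables can be realized with every matrix as its coefficient, since
every matrix is a sum of products of two traceless ones. Substituting \<open>x\<^sub>i \<mapsto> \<phi> b\<^sub>i\<close> into
\<open>f\<close>, where \<open>\<phi>\<close> is a sum of such products, and polarizing, one obtains identities of \<open>C\<close> that
represent a product of a fixed number \<open>m\<close> of such scalar functions times any given matrix
(\<open>identity_values_products\<close>). Consequently every product of coordinates, at least
\<open>2 m\<close> of them traceless, times a matrix is represented by an identity of \<open>C\<close>. A multilinear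
element is thus determined, modulo the identities of \<open>C\<close>, by its values at those \<open>n\<close>-tuples that
have matrix units at fewer than \<open>2 m\<close> places and the identity matrix elsewhere, and there are only
polynomially many of them (\<open>codim_bound\<close>).
\<close>

section \<open>Substitution in the free \<open>L\<close>-algebra\<close>

fun monom_derivative :: "('f::field, 'n::finite) der \<Rightarrow> (nat \<times> ('f, 'n) env) list \<Rightarrow> ('f, 'n) free_lalg"
  where
  "monom_derivative d [] = 0"
| "monom_derivative d [(i, u)] = free_monom [(i, env_inj d * u)]"
| "monom_derivative d ((i, u) # w # ws) =
     free_monom [(i, env_inj d * u)] * free_monom (w # ws) +
     free_monom [(i, u)] * monom_derivative d (w # ws)"

text \<open>The operations of the free algebra together with the derivations that extend \<open>x\<^sub>i\<^sup>u \<mapsto>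
  x\<^sub>i\<^sup>d\<^sup>u\<close>. A derivation is computed on the chosen representative of an element; this determines
  it up to elements that every substitution sends to zero, because the value of an element in an
  \<open>L\<close>-algebra is independent of the representative.\<close>

definition free_L_algebra :: "('f::field, ('f, 'n::finite) der, ('f, 'n) free_lalg) lalg" where
  "free_L_algebra = \<lparr>lalg_scale = free_scale, lalg_mult = (*),
     lalg_act = (\<lambda>d f. fa_extend free_scale (\<lambda>w. monom_derivative d (letters w)) (rep_free f))\<rparr>"

context
  fixes A :: "('f::field, ('f, 'n::finite) der, 'b::ab_group_add) lalg"
  assumes A: "is_L_algebra A"
begin

interpretation assoc_algebra "lalg_scale A" "lalg_mult A"
  using A by (simp add: is_L_algebra_def)

lemma free_eval_zero: "free_eval A b 0 = 0"
  using free_eval_simps(1)[OF A, of b 0 0] by simp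

lemma free_eval_sum: "free_eval A b (\<Sum>i\<in>I. f i) = (\<Sum>i\<in>I. free_eval A b (f i))"
  by (induction I rule: infinite_finite_induct) (simp_all add: free_eval_zero free_eval_simps[OF A])

lemma free_eval_minus: "free_eval A b (f - g) = free_eval A b f - free_eval A b g"
  using free_eval_simps(1)[OF A, of b "f - g" g] by simp

lemma free_eval_fa_extend:
  "free_eval A b (fa_extend free_scale g p) = fa_extend (lalg_scale A) (\<lambda>w. free_eval A b (g w)) p"
  by (simp add: fa_extend_def free_eval_sum free_eval_simps[OF A])

lemma free_eval_monom:
  "free_eval A b (free_monom ws) =
     nonempty_prod (lalg_mult A) (map (\<lambda>(i, u). env_action A u (b i)) ws)"
proof (induction ws rule: induct_list012)
  case 1
  have "free_monom [] = (0 :: ('f, 'n) free_lalg)"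
    by (simp add: free_monom.abs_eq zero_free_lalg_def)
  then show ?case by (simp add: free_eval_zero)
next
  case (3 w v ws)
  have "free_monom (w # v # ws) = free_monom [w] * free_monom (v # ws)"
    using free_monom_append[of "[w]" "v # ws"] by simp
  then show ?case
    using 3 by (cases w) (simp add: free_eval_simps[OF A])
qed (auto simp: free_eval_simps[OF A])

text \<open>The Leibniz rule in the target algebra is the rule by which the derivative of a monomial
  was built.\<close>

lemma free_eval_monom_derivative:
  "free_eval A b (monom_derivative d ws) =
     lalg_act A d (nonempty_prod (lalg_mult A) (map (\<lambda>(i, u). env_action A u (b i)) ws))"
proof (induction d ws rule: monom_derivative.induct)
  case (1 d)
  have "lalg_act A d 0 = 0"
    using act_simps(1)[OF A, of d 0 0] by simp
  then show ?case by (simp add: free_eval_zero)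
next
  case (3 d i u w ws)
  have leibniz: "lalg_act A d (lalg_mult A x y) =
      lalg_mult A (lalg_act A d x) y + lalg_mult A x (lalg_act A d y)" for x y
    using A by (simp add: is_L_algebra_def is_derivation_def)
  show ?case
    using 3 by (simp add: free_eval_simps[OF A] free_eval_monom leibniz env_action_simps[OF A]
        env_action_env_inj[OF A])
qed (simp add: free_eval_simps[OF A] env_action_simps[OF A] env_action_env_inj[OF A])

lemma lalg_act_fa_extend:
  "lalg_act A d (fa_extend (lalg_scale A) g p) = fa_extend (lalg_scale A) (\<lambda>w. lalg_act A d (g w)) p"
proof -
  have "lalg_act A d 0 = 0"
    using act_simps(1)[OF A, of d 0 0] by simp
  then interpret linear_act: additive "lalg_act A d"
    by unfold_locales (simp add: act_simps[OF A])
  show ?thesis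
    by (simp add: fa_extend_def linear_act.sum act_simps[OF A])
qed

lemma free_eval_act:
  "free_eval A b (lalg_act free_L_algebra d f) = lalg_act A d (free_eval A b f)"
proof -
  have "free_eval A b (lalg_act free_L_algebra d f) =
      fa_extend (lalg_scale A) (\<lambda>w. lalg_act A d (word_eval A b w)) (rep_free f)"
    by (simp add: free_L_algebra_def free_eval_fa_extend free_eval_monom_derivative
        word_eval_def)
  then show ?thesis
    by (simp add: free_eval_def lalg_act_fa_extend)
qed

lemma free_eval_env_action:
  "free_eval A b (env_action free_L_algebra u f) = env_action A u (free_eval A b f)"
proof -
  have "free_eval A b (foldr (lalg_act free_L_algebra) ds f) =
      foldr (lalg_act A) ds (free_eval A b f)" for ds
    by (induction ds) (simp_all add: free_eval_act)
  then have "free_eval A b (word_action free_L_algebra w f) = word_action A w (free_eval A b f)" for w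
    by (simp add: word_action_def)
  moreover have "lalg_scale free_L_algebra = (free_scale :: 'f \<Rightarrow> ('f, 'n) free_lalg \<Rightarrow> _)"
    by (simp add: free_L_algebra_def)
  ultimately show ?thesis
    by (simp add: env_action_def free_eval_fa_extend)
qed

text \<open>Evaluation respects addition, scalars, products and derivations, hence it commutes with
  the evaluation of \<open>f\<close> at elements \<open>h\<^sub>i\<close> of the free algebra. The identities of an \<open>L\<close>-algebra
  are therefore closed under substitution.\<close>

lemma free_eval_substitution:
  "free_eval A b (free_eval free_L_algebra h f) = free_eval A (\<lambda>i. free_eval A b (h i)) f"
proof -
  have prod: "free_eval A b (nonempty_prod (lalg_mult free_L_algebra) fs) =
      nonempty_prod (lalg_mult A) (map (free_eval A b) fs)" for fs
    by (induction fs rule: induct_list012)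
      (simp_all add: free_eval_zero free_L_algebra_def free_eval_simps[OF A])
  have "free_eval A b (word_eval free_L_algebra h w) = word_eval A (\<lambda>i. free_eval A b (h i)) w" for w
    by (simp add: word_eval_def prod split_def free_eval_env_action o_def)
  moreover have "lalg_scale free_L_algebra = (free_scale :: 'f \<Rightarrow> ('f, 'n) free_lalg \<Rightarrow> _)"
    by (simp add: free_L_algebra_def)
  ultimately show ?thesis
    by (simp add: free_eval_def[of free_L_algebra] free_eval_def[of A "\<lambda>i. free_eval A b (h i)"]
        free_eval_fa_extend)
qed

lemma word_eval_scale_substitution:
  "word_eval A (\<lambda>i. lalg_scale A t (b i)) w =
     lalg_scale A (t ^ length (letters w)) (word_eval A b w)"
proof -
  have "nonempty_prod (lalg_mult A) (map (\<lambda>(i, u). env_action A u (lalg_scale A t (b i))) ws) =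
     lalg_scale A (t ^ length ws) (nonempty_prod (lalg_mult A)
         (map (\<lambda>(i, u). env_action A u (b i)) ws))" for ws
    by (induction ws rule: induct_list012)
      (auto simp: env_action_simps[OF A] mult_scale_left mult_scale_right)
  then show ?thesis by (simp add: word_eval_def)
qed

end

text \<open>A monomial of length \<open>d\<close> is multiplied by \<open>t ^ d\<close> when every argument is multiplied by
  \<open>t\<close>, so along a line through the origin the value is a polynomial in \<open>t\<close>. It is normalized to
  have a nonzero top coefficient, the one that polarization will isolate.\<close>

lemma free_eval_along_line:
  assumes A: "is_L_algebra A" and nonzero: "free_eval A b f \<noteq> 0"
  obtains a D where "a D \<noteq> 0"
    and "\<And>t. free_eval A (\<lambda>i. lalg_scale A t (b i)) f = (\<Sum>d\<le>D. lalg_scale A (t ^ d) (a d))"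
proof -
  interpret assoc_algebra "lalg_scale A" "lalg_mult A"
    using A by (simp add: is_L_algebra_def)
  define K where "K = Poly_Mapping.keys (rep_free f)"
  define a where "a d = (\<Sum>w\<in>{w\<in>K. length (letters w) = d}.
     lalg_scale A (Poly_Mapping.lookup (rep_free f) w) (word_eval A b w))" for d
  define N where "N = Max (insert 0 ((length \<circ> letters) ` K))"
  have K: "finite K" unfolding K_def by simp
  have bound: "length (letters w) \<le> N" if "w \<in> K" for w
    unfolding N_def using that K by (intro Max_ge) auto
  have expand: "free_eval A (\<lambda>i. lalg_scale A t (b i)) f = (\<Sum>d\<le>N. lalg_scale A (t ^ d) (a d))" for t
  proof -
    have "free_eval A (\<lambda>i. lalg_scale A t (b i)) f = (\<Sum>w\<in>K. lalg_scale A (t ^ length (letters w))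
       (lalg_scale A (Poly_Mapping.lookup (rep_free f) w) (word_eval A b w)))"
      by (simp add: free_eval_def fa_extend_def K_def word_eval_scale_substitution[OF A] mult.commute)
    also have "\<dots> = (\<Sum>d\<le>N. \<Sum>w\<in>{w\<in>K. length (letters w) = d}. lalg_scale A (t ^ length (letters w))
       (lalg_scale A (Poly_Mapping.lookup (rep_free f) w) (word_eval A b w)))"
      using K bound by (intro sum.group[symmetric]) auto
    finally show ?thesis by (simp add: a_def scale_sum_right)
  qed
  define D where "D = Max {d. d \<le> N \<and> a d \<noteq> 0}"
  have "{d. d \<le> N \<and> a d \<noteq> 0} \<noteq> {}"
  proof
    assume "{d. d \<le> N \<and> a d \<noteq> 0} = {}"
    then have "(\<Sum>d\<le>N. lalg_scale A (1 ^ d) (a d)) = 0" by (intro sum.neutral) auto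
    then show False using expand[of 1] nonzero by simp
  qed
  then have D: "D \<le> N" "a D \<noteq> 0"
    using Max_in[of "{d. d \<le> N \<and> a d \<noteq> 0}"] unfolding D_def by auto
  have top: "a d = 0" if "d \<le> N" "\<not> d \<le> D" for d
    using that Max_ge[of "{d. d \<le> N \<and> a d \<noteq> 0}" d] unfolding D_def by auto
  show thesis
  proof (rule that)
    show "free_eval A (\<lambda>i. lalg_scale A t (b i)) f = (\<Sum>d\<le>D. lalg_scale A (t ^ d) (a d))" for t
      unfolding expand using D(1) top by (intro sum.mono_neutral_right) auto
  qed (rule D)
qed

section \<open>The enveloping algebra acting on matrices\<close>

definition commutator :: "'f::field^'n^'n \<Rightarrow> 'f^'n^'n \<Rightarrow> 'f^'n^'n" where
  "commutator A x = A ** x - x ** A"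

lemma is_derivation_commutator:
  "is_derivation mat_scale (**) (commutator (A :: 'f::field^'n^'n))"
  by (simp add: is_derivation_mat_iff commutator_def mat_algebra_simps matrix_mul_assoc algebra_simps)

definition unit_matrix :: "'n \<Rightarrow> 'n \<Rightarrow> 'f::field^'n^'n" where
  "unit_matrix p q = (\<chi> i j. if i = p \<and> j = q then 1 else 0)"

lemma unit_matrix_nth: "unit_matrix p q $ i $ j = (if i = p \<and> j = q then 1 else 0)"
  by (simp add: unit_matrix_def)

lemma unit_matrix_mult_nth:
  fixes x :: "'f::field^'n^'n"
  shows "(unit_matrix p q ** x) $ i $ j = (if i = p then x $ q $ j else 0)"
    and "(x ** unit_matrix p q) $ i $ j = (if j = q then x $ i $ p else 0)"
  by (simp_all add: matrix_matrix_mult_def unit_matrix_def if_distrib[of "\<lambda>c. c * _"]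
      if_distrib[of "\<lambda>c. _ * c"] sum.delta cong: if_cong conj_cong)

lemma unit_matrix_mult:
  "unit_matrix p q ** unit_matrix r s = (if q = r then unit_matrix p s else 0 :: 'f::field^'n^'n)"
  by (auto simp: vec_eq_iff unit_matrix_mult_nth unit_matrix_nth)

lemma mat_scale_nth: "mat_scale c A $ i $ j = c * A $ i $ j"
  by (simp add: mat_scale_def)

lemmas entrywise = vec_eq_iff unit_matrix_mult_nth unit_matrix_nth mat_scale_nth commutator_def

text \<open>The image of the universal enveloping algebra in the linear endomorphisms of the matrix
  algebra.\<close>

definition env_maps :: "('f::field^'n^'n \<Rightarrow> 'f^'n^'n) set" where
  "env_maps = range (env_action mat_lalg)"

lemma env_maps_closed:
  fixes \<phi> \<psi> :: "'f::field^'n^'n \<Rightarrow> 'f^'n^'n"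
  assumes "\<phi> \<in> env_maps"
  shows "\<psi> \<in> env_maps \<Longrightarrow> (\<lambda>x. \<phi> x + \<psi> x) \<in> env_maps"
    and "(\<lambda>x. mat_scale c (\<phi> x)) \<in> env_maps"
    and "\<psi> \<in> env_maps \<Longrightarrow> (\<lambda>x. \<phi> (\<psi> x)) \<in> env_maps"
    and "\<psi> \<in> env_maps \<Longrightarrow> (\<lambda>x. \<phi> x - \<psi> x) \<in> env_maps"
proof -
  note simps = env_action_simps[OF is_L_algebra_mat_lalg]
  have scale: "lalg_scale mat_lalg = (mat_scale :: 'f \<Rightarrow> 'f^'n^'n \<Rightarrow> _)"
    by (simp add: mat_lalg_def)
  obtain u where u: "\<phi> = env_action mat_lalg u"
    using assms by (auto simp: env_maps_def)
  show "(\<lambda>x. mat_scale c (\<phi> x)) \<in> env_maps"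
    unfolding env_maps_def
    by (rule range_eqI[of _ _ "env_scale c u"]) (auto simp: u simps scale)
  assume "\<psi> \<in> env_maps"
  then obtain v where v: "\<psi> = env_action mat_lalg v"
    by (auto simp: env_maps_def)
  show "(\<lambda>x. \<phi> x + \<psi> x) \<in> env_maps"
    unfolding env_maps_def by (rule range_eqI[of _ _ "u + v"]) (auto simp: u v simps)
  show "(\<lambda>x. \<phi> (\<psi> x)) \<in> env_maps"
    unfolding env_maps_def by (rule range_eqI[of _ _ "u * v"]) (auto simp: u v simps)
  show "(\<lambda>x. \<phi> x - \<psi> x) \<in> env_maps"
    unfolding env_maps_def
  proof (rule range_eqI[of _ _ "u - v"], rule ext)
    show "\<phi> x - \<psi> x = env_action mat_lalg (u - v) x" for x
      using simps(3)[of "u - v" v x] by (simp add: u v)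
  qed
qed

lemma ident_env_maps: "(\<lambda>x. x) \<in> env_maps"
  unfolding env_maps_def
  by (rule range_eqI[of _ _ 1]) (auto simp: env_action_simps[OF is_L_algebra_mat_lalg])

lemma zero_env_maps: "(\<lambda>x. 0) \<in> env_maps"
  using env_maps_closed(4)[OF ident_env_maps ident_env_maps] by simp

lemma sum_env_maps:
  "(\<And>i. i \<in> I \<Longrightarrow> \<phi> i \<in> env_maps) \<Longrightarrow> (\<lambda>x. \<Sum>i\<in>I. \<phi> i x) \<in> env_maps"
  by (induction I rule: infinite_finite_induct) (simp_all add: zero_env_maps env_maps_closed)

lemma commutator_env_maps: "commutator A \<in> env_maps"
proof -
  have "Rep_der (Abs_der (commutator A)) = commutator A"
    by (intro Abs_der_inverse) (simp add: is_derivation_commutator)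
  then show ?thesis
    unfolding env_maps_def
    by (intro range_eqI[of _ _ "env_inj (Abs_der (commutator A))"])
      (simp add: fun_eq_iff env_action_env_inj[OF is_L_algebra_mat_lalg], simp add: mat_lalg_def)
qed

text \<open>The map \<open>\<eta> \<otimes> d\<close>, of rank at most one, comes from the enveloping algebra.\<close>

definition tensor_env_map :: "('f::field^'n^'n \<Rightarrow> 'f) \<Rightarrow> 'f^'n^'n \<Rightarrow> bool" where
  "tensor_env_map \<eta> d \<longleftrightarrow> (\<lambda>x. mat_scale (\<eta> x) d) \<in> env_maps"

lemma tensor_env_map_closed:
  fixes d :: "'f::field^'n^'n"
  shows "tensor_env_map \<eta> d \<Longrightarrow> \<phi> \<in> env_maps \<Longrightarrow> tensor_env_map (\<lambda>x. \<eta> (\<phi> x)) d"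
    and "tensor_env_map \<eta> d \<Longrightarrow> tensor_env_map \<eta> (commutator A d)"
    and "tensor_env_map \<eta> d \<Longrightarrow> tensor_env_map (\<lambda>x. c * \<eta> x) d"
    and "(\<And>i. i \<in> I \<Longrightarrow> tensor_env_map (\<theta> i) d) \<Longrightarrow> tensor_env_map (\<lambda>x. \<Sum>i\<in>I. \<theta> i x) d"
proof -
  have d0: "mat_scale 0 d = 0" by (simp add: entrywise)
  have dsum: "mat_scale (\<Sum>i\<in>I. \<theta> i x) d = (\<Sum>i\<in>I. mat_scale (\<theta> i x) d)" for x
    by (induction I rule: infinite_finite_induct) (simp_all add: mat_algebra_simps d0)
  show "tensor_env_map \<eta> d \<Longrightarrow> \<phi> \<in> env_maps \<Longrightarrow> tensor_env_map (\<lambda>x. \<eta> (\<phi> x)) d"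
    unfolding tensor_env_map_def by (rule env_maps_closed(3))
  show "tensor_env_map \<eta> d \<Longrightarrow> tensor_env_map \<eta> (commutator A d)"
    using env_maps_closed(3)[OF commutator_env_maps, of "\<lambda>x. mat_scale (\<eta> x) d" A]
    by (simp add: tensor_env_map_def commutator_def mat_algebra_simps)
  show "tensor_env_map \<eta> d \<Longrightarrow> tensor_env_map (\<lambda>x. c * \<eta> x) d"
    using env_maps_closed(2)[of "\<lambda>x. mat_scale (\<eta> x) d"]
    by (simp add: tensor_env_map_def mat_algebra_simps)
  show "(\<And>i. i \<in> I \<Longrightarrow> tensor_env_map (\<theta> i) d) \<Longrightarrow> tensor_env_map (\<lambda>x. \<Sum>i\<in>I. \<theta> i x) d"
    using sum_env_maps[of I "\<lambda>i x. mat_scale (\<theta> i x) d"] by (simp add: tensor_env_map_def dsum)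
qed

text \<open>Since \<open>E\<^sub>p\<^sub>q\<close> squares to zero, the square of its commutator map is \<open>x \<mapsto> -2 E\<^sub>p\<^sub>q x E\<^sub>p\<^sub>q\<close>.
  If 2 is invertible, this yields the first rank one maps in the enveloping algebra.\<close>

lemma square_of_unit_commutator:
  fixes x :: "'f::field^'n^'n"
  assumes "p \<noteq> q"
  shows "commutator (unit_matrix p q) (commutator (unit_matrix p q) x) =
     mat_scale (-2 * x $ q $ p) (unit_matrix p q)"
  using assms by (auto simp: entrywise mat_algebra_simps)

text \<open>Two commutators carry \<open>E\<^sub>p\<^sub>q\<close> to a multiple of any prescribed off-diagonal unit. Of the
  four terms of the double commutator two can survive, and they coincide if both do, which
  happens for \<open>(u, v) = (q, p)\<close>.\<close>

lemma unit_commutators_transitive: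
  fixes p q u v :: "'n::finite"
  assumes "p \<noteq> q" "u \<noteq> v"
  shows "commutator (unit_matrix u p) (commutator (unit_matrix q v)
      (unit_matrix p q :: 'f::field^'n^'n)) =
     mat_scale (if u = q \<and> v = p then -2 else -1) (unit_matrix u v)"
proof -
  have double: "mat_scale (- 1) A - A = mat_scale (- 2) A" and minus: "- A = mat_scale (- 1) A"
      for A :: "'f^'n^'n"
    by (simp_all add: vec_eq_iff mat_scale_nth)
  show ?thesis
    using assms by (auto simp: commutator_def unit_matrix_mult mat_algebra_simps double minus)
qed

lemma tensor_env_map_off_diagonal:
  fixes p q u v :: "'n::finite"
  assumes "p \<noteq> q" "u \<noteq> v"
  shows "tensor_env_map (\<lambda>x. x $ q $ p) (unit_matrix u v :: 'f::field_char_0^'n^'n)"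
proof -
  define c :: 'f where "c = (if u = q \<and> v = p then -2 else -1)"
  have "c \<noteq> 0" by (simp add: c_def)
  have "tensor_env_map (\<lambda>x. -2 * x $ q $ p) (unit_matrix p q :: 'f^'n^'n)"
    using env_maps_closed(3)[OF commutator_env_maps commutator_env_maps,
        of "unit_matrix p q :: 'f^'n^'n" "unit_matrix p q"] assms
    by (simp add: tensor_env_map_def square_of_unit_commutator)
  from tensor_env_map_closed(3)[OF this, of "-1/2"]
  have "tensor_env_map (\<lambda>x. x $ q $ p) (unit_matrix p q :: 'f^'n^'n)" by simp
  then have "tensor_env_map (\<lambda>x. x $ q $ p) (mat_scale c (unit_matrix u v))"
    using tensor_env_map_closed(2) unit_commutators_transitive[OF assms] unfolding c_def by metis
  then have "tensor_env_map (\<lambda>x. x $ q $ p * c) (unit_matrix u v)"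
    by (simp add: tensor_env_map_def mat_algebra_simps)
  from tensor_env_map_closed(3)[OF this, of "1/c"] show ?thesis
    using \<open>c \<noteq> 0\<close> by (simp add: field_simps)
qed

text \<open>A spanning set of the traceless matrices.\<close>

definition sl_generators :: "('f::field^'n^'n) set" where
  "sl_generators = {unit_matrix u v | u v. u \<noteq> v} \<union>
     {unit_matrix u u - unit_matrix v v | u v. u \<noteq> v}"

definition normalized_trace :: "'f::field^'n^'n \<Rightarrow> 'f" where
  "normalized_trace x = (\<Sum>i\<in>UNIV. x $ i $ i) / of_nat CARD('n)"

text \<open>Coordinates for the decomposition of the matrix algebra into the scalar matrices, with
  index \<open>None\<close>, and the traceless ones. The index \<open>Some (p, q)\<close> stands for an entry of the
  traceless part; these entries are redundant, as those on the diagonal add up to zero, which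
  keeps the indexing uniform.\<close>

fun coord :: "('n \<times> 'n) option \<Rightarrow> 'f::field^'n^'n \<Rightarrow> 'f" where
  "coord None x = normalized_trace x"
| "coord (Some (p, q)) x = x $ p $ q - (if p = q then normalized_trace x else 0)"

fun coord_matrix :: "('n \<times> 'n) option \<Rightarrow> 'f::field^'n^'n" where
  "coord_matrix None = mat 1"
| "coord_matrix (Some (p, q)) = unit_matrix p q"

text \<open>Every functional that kills the identity matrix is a combination of off-diagonal entries
  and differences of diagonal entries. The off-diagonal entries are available already, and a
  difference of diagonal entries is an off-diagonal entry of a commutator with a matrix unit.
  Likewise the diagonal elements of \<open>sl_generators\<close> are commutators of off-diagonal units.\<close>

lemma tensor_env_map_coord:
  fixes d :: "'f::field_char_0^'n^'n"
  assumes d: "d \<in> sl_generators"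
  shows "tensor_env_map (coord (Some (p, q))) d"
proof -
  have entry: "tensor_env_map (\<lambda>x. x $ q $ p) d" if "p \<noteq> q" for p q
  proof -
    have "unit_matrix u u - unit_matrix v v =
        commutator (unit_matrix u v) (unit_matrix v u :: 'f^'n^'n)" if "u \<noteq> v" for u v
      using that by (auto simp: entrywise)
    with d consider u v where "u \<noteq> v" "d = unit_matrix u v" |
      u v where "u \<noteq> v" "d = commutator (unit_matrix u v) (unit_matrix v u)"
      unfolding sl_generators_def by auto
    then show ?thesis
    proof cases
      case 1
      then show ?thesis using that by (simp add: tensor_env_map_off_diagonal)
    next
      case 2
      have "tensor_env_map (\<lambda>x. x $ q $ p) (unit_matrix v u :: 'f^'n^'n)"
        using that 2 by (simp add: tensor_env_map_off_diagonal)
      then show ?thesis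
        unfolding 2(2) by (rule tensor_env_map_closed(2))
    qed
  qed
  have diff: "tensor_env_map (\<lambda>x. x $ p $ p - x $ q $ q) d" for p q
  proof (cases "p = q")
    case True
    have "mat_scale 0 d = 0" by (simp add: entrywise)
    then show ?thesis using True zero_env_maps by (simp add: tensor_env_map_def)
  next
    case False
    then have "(\<lambda>x :: 'f^'n^'n. commutator (unit_matrix q p) x $ q $ p) = (\<lambda>x. x $ p $ p - x $ q $ q)"
      by (auto simp: entrywise)
    then show ?thesis
      using tensor_env_map_closed(1)[OF entry commutator_env_maps[of "unit_matrix q p"], of p q] False
      by simp
  qed
  show ?thesis
  proof (cases "p = q")
    case True
    have "coord (Some (p, q)) x =
        1 / of_nat CARD('n) * (\<Sum>i\<in>UNIV. x $ p $ p - x $ i $ i)" for x :: "'f^'n^'n"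
      by (simp add: True normalized_trace_def sum_subtractf field_simps)
    then have "coord (Some (p, q)) = (\<lambda>x :: 'f^'n^'n. 1 / of_nat CARD('n) *
        (\<Sum>i\<in>UNIV. x $ p $ p - x $ i $ i))"
      by (rule ext)
    moreover have "tensor_env_map (\<lambda>x. \<Sum>i\<in>UNIV. x $ p $ p - x $ i $ i) d"
      by (intro tensor_env_map_closed(4) diff)
    ultimately show ?thesis
      by (simp only: tensor_env_map_closed(3))
  next
    case False
    then have "coord (Some (p, q)) = (\<lambda>x :: 'f^'n^'n. x $ p $ q)"
      by (intro ext) simp
    then show ?thesis using entry[of q p] False by simp
  qed
qed

lemma sum_diagonal_coord:
  "(\<Sum>p\<in>UNIV. coord (Some (p, p)) (x :: 'f::field_char_0^'n^'n)) = 0"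
  by (simp add: sum_subtractf normalized_trace_def)

lemma matrix_by_traceless_coord:
  "(x :: 'f::field^'n^'n) = mat_scale (normalized_trace x) (mat 1) +
     (\<Sum>p\<in>UNIV. \<Sum>q\<in>UNIV. mat_scale (coord (Some (p, q)) x) (unit_matrix p q))"
proof -
  have "(\<Sum>p\<in>UNIV. \<Sum>q\<in>UNIV. mat_scale (coord (Some (p, q)) x) (unit_matrix p q)) $ i $ j =
      coord (Some (i, j)) x" for i j
  proof -
    have "(\<Sum>p\<in>UNIV. \<Sum>q\<in>UNIV. mat_scale (coord (Some (p, q)) x) (unit_matrix p q)) $ i $ j =
      (\<Sum>p\<in>UNIV. \<Sum>q\<in>UNIV. if i = p then if j = q then coord (Some (p, q)) x else 0 else 0)"
      by (simp del: coord.simps add: mat_scale_nth unit_matrix_nth if_distrib[of "\<lambda>c. _ * c"]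
          cong: if_cong)
       (intro sum.cong refl, simp)
    also have "\<dots> = (\<Sum>p\<in>UNIV. if i = p then coord (Some (p, j)) x else 0)"
      by (intro sum.cong refl) (simp del: coord.simps)
    finally show ?thesis by (simp del: coord.simps)
  qed
  then show ?thesis
    by (simp add: vec_eq_iff mat_scale_nth mat_def)
qed

lemma matrix_by_coord:
  "(\<Sum>k\<in>UNIV. mat_scale (coord k x) (coord_matrix k)) = (x :: 'f::field^'n^'n)"
proof -
  have "(\<Sum>k\<in>UNIV. mat_scale (coord k x) (coord_matrix k)) = mat_scale (normalized_trace x) (mat 1) +
     (\<Sum>k\<in>UNIV. mat_scale (coord (Some k) x) (coord_matrix (Some k)))"
    by (simp add: UNIV_option_conv sum.insert sum.reindex o_def)
  also have "(\<Sum>k\<in>UNIV. mat_scale (coord (Some k) x) (coord_matrix (Some k))) =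
     (\<Sum>p\<in>UNIV. \<Sum>q\<in>UNIV. mat_scale (coord (Some (p, q)) x) (unit_matrix p q))"
    by (simp add: sum.cartesian_product split_def flip: UNIV_Times_UNIV)
      (intro sum.cong refl, auto)
  finally show ?thesis using matrix_by_traceless_coord[of x] by simp
qed

text \<open>The projection onto the scalar matrices is the identity minus the projection onto the
  traceless matrices, and the latter is a sum of rank one maps.\<close>

lemma tensor_env_map_trace:
  "tensor_env_map normalized_trace (mat 1 :: 'f::field_char_0^'n^'n)"
proof -
  fix r :: 'n
  \<comment> \<open>The traceless part of \<open>x\<close> is expanded with the traceless matrices
    \<open>E\<^sub>p\<^sub>p - E\<^sub>r\<^sub>r\<close> in place of \<open>E\<^sub>p\<^sub>p\<close>; the change adds up to zero because the
    diagonal coordinates do.\<close>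
  define d :: "'n \<Rightarrow> 'n \<Rightarrow> 'f^'n^'n" where
    "d p q = unit_matrix p q - (if p = q then unit_matrix r r else 0)" for p q
  have "(\<lambda>x. mat_scale (coord (Some (p, q)) x) (d p q)) \<in> env_maps" for p q
  proof (cases "d p q = 0")
    case True
    then show ?thesis by (simp add: mat_algebra_simps zero_env_maps)
  next
    case False
    then have "d p q \<in> sl_generators"
      by (auto simp: d_def sl_generators_def split: if_splits)
    then show ?thesis using tensor_env_map_coord tensor_env_map_def by metis
  qed
  then have "(\<lambda>x. x - (\<Sum>p\<in>UNIV. \<Sum>q\<in>UNIV. mat_scale (coord (Some (p, q)) x) (d p q))) \<in> env_maps"
    by (intro env_maps_closed(4) ident_env_maps sum_env_maps)
  moreover have "x - (\<Sum>p\<in>UNIV. \<Sum>q\<in>UNIV. mat_scale (coord (Some (p, q)) x) (d p q)) =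
      mat_scale (normalized_trace x) (mat 1)" for x
  proof -
    have zero: "mat_scale (coord (Some (p, q)) x) 0 = 0" for p q by (simp add: mat_algebra_simps)
    have scale_sum: "(\<Sum>p\<in>P. mat_scale (f p) (A :: 'f^'n^'n)) = mat_scale (\<Sum>p\<in>P. f p) A"
        for P :: "'n set" and f A
      by (induction P rule: infinite_finite_induct) (simp_all add: mat_algebra_simps entrywise)
    have "(\<Sum>p\<in>UNIV. \<Sum>q\<in>UNIV. mat_scale (coord (Some (p, q)) x) (if p = q then unit_matrix r r else 0))
       = (\<Sum>p\<in>UNIV. \<Sum>q\<in>UNIV. if p = q then mat_scale (coord (Some (p, p)) x) (unit_matrix r r) else 0)"
      by (intro sum.cong refl) (simp add: mat_algebra_simps)
    also have "\<dots> = (\<Sum>p\<in>UNIV. mat_scale (coord (Some (p, p)) x) (unit_matrix r r))"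
      by (simp del: coord.simps)
    also have "\<dots> = 0"
      by (simp only: scale_sum sum_diagonal_coord) (simp add: entrywise)
    finally show ?thesis
      using matrix_by_traceless_coord[of x]
      by (simp del: coord.simps add: d_def mat_algebra_simps sum_subtractf diff_eq_eq)
  qed
  ultimately show ?thesis by (simp del: coord.simps add: tensor_env_map_def)
qed

section \<open>Functions on matrices represented by the free algebra\<close>

definition generic_values :: "((nat \<Rightarrow> 'f::field^'n^'n) \<Rightarrow> 'f^'n^'n) set" where
  "generic_values = range (\<lambda>g b. free_eval mat_lalg b g)"

text \<open>For \<open>C\<close> in the variety of the matrix algebra, whether an element of the free algebra is an
  identity of \<open>C\<close> depends only on the function that it represents on matrices. These are the
  functions represented by identities of \<open>C\<close>; they form an ideal among the generic values.\<close>

definition identity_values ::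
    "('f::field, ('f, 'n::finite) der, 'b::ab_group_add) lalg \<Rightarrow>
     ((nat \<Rightarrow> 'f^'n^'n) \<Rightarrow> 'f^'n^'n) set" where
  "identity_values C = (\<lambda>g b. free_eval mat_lalg b g) ` L_identities C"

lemma mat_lalg_simps: "lalg_scale mat_lalg = mat_scale" "lalg_mult mat_lalg = (**)"
  by (simp_all add: mat_lalg_def)

lemmas free_eval_mat_simps =
  free_eval_simps[OF is_L_algebra_mat_lalg, unfolded mat_lalg_simps]

lemma generic_values_closed:
  fixes \<phi> \<psi> :: "(nat \<Rightarrow> 'f::field^'n^'n) \<Rightarrow> 'f^'n^'n"
  assumes "\<phi> \<in> generic_values"
  shows "\<psi> \<in> generic_values \<Longrightarrow> (\<lambda>b. \<phi> b + \<psi> b) \<in> generic_values"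
    and "(\<lambda>b. mat_scale c (\<phi> b)) \<in> generic_values"
    and "\<psi> \<in> generic_values \<Longrightarrow> (\<lambda>b. \<phi> b ** \<psi> b) \<in> generic_values"
proof -
  obtain f where f: "\<phi> = (\<lambda>b. free_eval mat_lalg b f)"
    using assms by (auto simp: generic_values_def)
  show "(\<lambda>b. mat_scale c (\<phi> b)) \<in> generic_values"
    unfolding generic_values_def
    by (rule range_eqI[of _ _ "free_scale c f"]) (simp add: f free_eval_mat_simps)
  assume "\<psi> \<in> generic_values"
  then obtain g where g: "\<psi> = (\<lambda>b. free_eval mat_lalg b g)"
    by (auto simp: generic_values_def)
  show "(\<lambda>b. \<phi> b + \<psi> b) \<in> generic_values"
    unfolding generic_values_def
    by (rule range_eqI[of _ _ "f + g"]) (simp add: f g free_eval_mat_simps)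
  show "(\<lambda>b. \<phi> b ** \<psi> b) \<in> generic_values"
    unfolding generic_values_def
    by (rule range_eqI[of _ _ "f * g"]) (simp add: f g free_eval_mat_simps)
qed

lemma zero_generic_values: "(\<lambda>b. 0) \<in> generic_values"
  unfolding generic_values_def
  by (rule range_eqI[of _ _ 0]) (simp add: free_eval_zero[OF is_L_algebra_mat_lalg])

lemma sum_generic_values:
  "(\<And>i. i \<in> I \<Longrightarrow> \<phi> i \<in> generic_values) \<Longrightarrow> (\<lambda>b. \<Sum>i\<in>I. \<phi> i b) \<in> generic_values"
  by (induction I rule: infinite_finite_induct)
      (simp_all add: zero_generic_values generic_values_closed)

lemma env_map_generic_value:
  assumes "\<phi> \<in> env_maps"
  shows "(\<lambda>b. \<phi> (b i)) \<in> generic_values"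
proof -
  obtain u where "\<phi> = env_action mat_lalg u"
    using assms by (auto simp: env_maps_def)
  then show ?thesis
    unfolding generic_values_def
    by (intro range_eqI[of _ _ "free_monom [(i, u)]"]) (simp add: free_eval_mat_simps)
qed

lemma identity_values_closed:
  fixes \<phi> \<psi> :: "(nat \<Rightarrow> 'f::field^'n^'n) \<Rightarrow> 'f^'n^'n"
  assumes C: "is_L_algebra C" and \<phi>: "\<phi> \<in> identity_values C"
  shows "\<psi> \<in> identity_values C \<Longrightarrow> (\<lambda>b. \<phi> b + \<psi> b) \<in> identity_values C"
    and "(\<lambda>b. mat_scale c (\<phi> b)) \<in> identity_values C"
    and "\<psi> \<in> generic_values \<Longrightarrow> (\<lambda>b. \<phi> b ** \<psi> b) \<in> identity_values C"
    and "\<psi> \<in> generic_values \<Longrightarrow> (\<lambda>b. \<psi> b ** \<phi> b) \<in> identity_values C"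
proof -
  interpret assoc_algebra "lalg_scale C" "lalg_mult C"
    using C by (simp add: is_L_algebra_def)
  note simps = free_eval_simps[OF C] mult_zero[OF C]
  obtain f where f: "\<phi> = (\<lambda>b. free_eval mat_lalg b f)" "\<And>b. free_eval C b f = 0"
    using \<phi> by (auto simp: identity_values_def L_identities_def)
  show "(\<lambda>b. \<phi> b + \<psi> b) \<in> identity_values C" if \<psi>: "\<psi> \<in> identity_values C"
  proof -
    obtain g where g: "\<psi> = (\<lambda>b. free_eval mat_lalg b g)" "\<And>b. free_eval C b g = 0"
      using \<psi> by (auto simp: identity_values_def L_identities_def)
    show ?thesis
      unfolding identity_values_def L_identities_def
      by (rule image_eqI[of _ _ "f + g"]) (simp_all add: f g simps free_eval_mat_simps)
  qed
  show "(\<lambda>b. mat_scale c (\<phi> b)) \<in> identity_values C"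
    unfolding identity_values_def L_identities_def
    by (rule image_eqI[of _ _ "free_scale c f"]) (simp_all add: f simps free_eval_mat_simps)
  assume "\<psi> \<in> generic_values"
  then obtain g where g: "\<psi> = (\<lambda>b. free_eval mat_lalg b g)"
    by (auto simp: generic_values_def)
  show "(\<lambda>b. \<phi> b ** \<psi> b) \<in> identity_values C"
    unfolding identity_values_def L_identities_def
    by (rule image_eqI[of _ _ "f * g"]) (simp_all add: f g simps free_eval_mat_simps)
  show "(\<lambda>b. \<psi> b ** \<phi> b) \<in> identity_values C"
    unfolding identity_values_def L_identities_def
    by (rule image_eqI[of _ _ "g * f"]) (simp_all add: f g simps free_eval_mat_simps)
qed

lemma zero_identity_values:
  assumes C: "is_L_algebra C"
  shows "(\<lambda>b. 0) \<in> identity_values C"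
  unfolding identity_values_def L_identities_def
  by (rule image_eqI[of _ _ 0])
    (simp_all add: free_eval_zero[OF is_L_algebra_mat_lalg] free_eval_zero[OF C])

lemma sum_identity_values:
  assumes C: "is_L_algebra C"
  shows "(\<And>i. i \<in> I \<Longrightarrow> \<phi> i \<in> identity_values C) \<Longrightarrow>
    (\<lambda>b. \<Sum>i\<in>I. \<phi> i b) \<in> identity_values C"
  by (induction I rule: infinite_finite_induct)
    (simp_all add: zero_identity_values[OF C] identity_values_closed[OF C])

lemma matrix_by_units:
  "(B :: 'f::field^'n^'n) = (\<Sum>p\<in>UNIV. \<Sum>q\<in>UNIV. mat_scale (B $ p $ q) (unit_matrix p q))"
proof -
  have "(\<Sum>p\<in>UNIV. \<Sum>q\<in>UNIV. mat_scale (B $ p $ q) (unit_matrix p q)) $ i $ j = B $ i $ j" for i j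
  proof -
    have "(\<Sum>p\<in>UNIV. \<Sum>q\<in>UNIV. mat_scale (B $ p $ q) (unit_matrix p q)) $ i $ j =
      (\<Sum>p\<in>UNIV. \<Sum>q\<in>UNIV. if i = p then if j = q then B $ p $ q else 0 else 0)"
      by (simp add: mat_scale_nth unit_matrix_nth) (intro sum.cong refl, simp)
    also have "\<dots> = (\<Sum>p\<in>UNIV. if i = p then B $ p $ j else 0)"
      by (intro sum.cong refl) simp
    finally show ?thesis by simp
  qed
  then show ?thesis by (simp add: vec_eq_iff)
qed

text \<open>Although one traceless factor yields only traceless matrices, products of two of them
  reach every matrix unit, the diagonal ones included.\<close>

lemma unit_matrix_factorization:
  fixes p q :: "'n::finite"
  assumes "CARD('n) \<ge> 2"
  obtains d e :: "'f::field^'n^'n"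
  where "d \<in> sl_generators" "e \<in> sl_generators" "unit_matrix p q = d ** e"
proof (cases "p = q")
  case False
  show thesis
    by (rule that[of "unit_matrix p p - unit_matrix q q" "unit_matrix p q"])
      (use False in \<open>auto simp: sl_generators_def mat_algebra_simps unit_matrix_mult\<close>)
next
  case True
  have "UNIV \<noteq> {p}"
    using assms by (metis card_1_singleton_iff One_nat_def not_numeral_le_zero numeral_le_one_iff
        semiring_norm(69))
  then obtain r where "r \<noteq> p" by auto
  then show thesis
    using that[of "unit_matrix p r" "unit_matrix r p"] True
    by (auto simp: sl_generators_def unit_matrix_mult)
qed

text \<open>The scalar functions that can be realized with every matrix as a coefficient.\<close>

definition scalar_values :: "((nat \<Rightarrow> 'f::field^'n^'n) \<Rightarrow> 'f) set" where
  "scalar_values = {a. \<forall>B. (\<lambda>b. mat_scale (a b) B) \<in> generic_values}"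

lemma scalar_valuesI:
  fixes a :: "(nat \<Rightarrow> 'f::field^'n^'n) \<Rightarrow> 'f"
  assumes units: "\<And>p q. (\<lambda>b. mat_scale (a b) (unit_matrix p q)) \<in> generic_values"
  shows "a \<in> scalar_values"
  unfolding scalar_values_def
proof (intro CollectI allI)
  fix B :: "'f^'n^'n"
  have "mat_scale (a b) B = (\<Sum>p\<in>UNIV. \<Sum>q\<in>UNIV. mat_scale (B $ p $ q)
      (mat_scale (a b) (unit_matrix p q)))" for b
    using matrix_by_units[of "mat_scale (a b) B"]
    by (simp add: mat_scale_nth mat_algebra_simps mult.commute)
  moreover have "(\<lambda>b. \<Sum>p\<in>UNIV. \<Sum>q\<in>UNIV. mat_scale (B $ p $ q) (mat_scale (a b) (unit_matrix p q)))
      \<in> generic_values"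
    by (intro sum_generic_values generic_values_closed(2) units)
  ultimately show "(\<lambda>b. mat_scale (a b) B) \<in> generic_values"
    by simp
qed

lemma traceless_coord_generic_value:
  fixes d :: "'f::field_char_0^'n^'n"
  assumes "d \<in> sl_generators"
  shows "(\<lambda>b. mat_scale (coord (Some k) (b i)) d) \<in> generic_values"
  using env_map_generic_value[OF tensor_env_map_coord[OF assms, unfolded tensor_env_map_def]]
  by (cases k) blast

lemma coord_pair_scalar_value:
  fixes k l :: "'n::finite \<times> 'n"
  assumes "CARD('n) \<ge> 2"
  shows "(\<lambda>b. coord (Some k) (b i) * coord (Some l) (b j :: 'f::field_char_0^'n^'n)) \<in> scalar_values"
proof (rule scalar_valuesI)
  fix p q :: 'n
  obtain d e :: "'f^'n^'n" where de: "d \<in> sl_generators" "e \<in> sl_generators" "unit_matrix p q = d ** e"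
    using unit_matrix_factorization[OF assms] by blast
  from generic_values_closed(3)[OF traceless_coord_generic_value traceless_coord_generic_value,
      OF de(1,2)]
  show "(\<lambda>b. mat_scale (coord (Some k) (b i) * coord (Some l) (b j))
      (unit_matrix p q :: 'f^'n^'n)) \<in> generic_values"
    by (simp add: de(3) mat_algebra_simps del: coord.simps)
qed

text \<open>The scalar coordinate is realized by a scalar matrix. A traceless coordinate is realized
  on the first factor of \<open>E\<^sub>p\<^sub>q = d e\<close>, and the second factor carries \<open>a\<close>.\<close>

lemma coord_times_scalar_value:
  fixes a :: "(nat \<Rightarrow> 'f::field_char_0^'n^'n) \<Rightarrow> 'f"
  assumes card: "CARD('n) \<ge> 2" and a: "a \<in> scalar_values"
  shows "(\<lambda>b. coord k (b i) * a b) \<in> scalar_values"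
proof (rule scalar_valuesI)
  fix p q :: 'n
  have aB: "(\<lambda>b. mat_scale (a b) B) \<in> generic_values" for B
    using a by (simp add: scalar_values_def)
  show "(\<lambda>b. mat_scale (coord k (b i) * a b) (unit_matrix p q :: 'f^'n^'n)) \<in> generic_values"
  proof (cases k)
    case None
    show ?thesis
      using generic_values_closed(3)[OF env_map_generic_value[OF
        tensor_env_map_trace[unfolded tensor_env_map_def], of i] aB[of "unit_matrix p q"]]
      by (simp add: None mat_algebra_simps mult.commute)
  next
    case (Some l)
    obtain d e :: "'f^'n^'n" where de: "d \<in> sl_generators" "e \<in> sl_generators"
        "unit_matrix p q = d ** e"
      using unit_matrix_factorization[OF card] by blast
    from generic_values_closed(3)[OF traceless_coord_generic_value aB, OF de(1), of l i e]
    show ?thesis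
      by (simp add: Some de(3) mat_algebra_simps mult.commute del: coord.simps)
  qed
qed

text \<open>The alternating sum over subsets is an iterated difference, which lowers the degree by one
  for every element of \<open>V\<close>: it kills the powers below \<open>card V\<close> and turns the power \<open>card V\<close> into
  a product.\<close>

lemma polarization:
  fixes a :: "'i \<Rightarrow> 'r::{comm_ring_1,semiring_char_0}"
  assumes "finite V" "e \<le> card V"
  shows "(\<Sum>S\<in>Pow V. (-1) ^ (card V - card S) * (\<Sum>j\<in>S. a j) ^ e) =
    (if e = card V then fact (card V) * (\<Prod>j\<in>V. a j) else 0)"
  using assms
proof (induction V arbitrary: e)
  case empty
  then show ?case by simp
next
  case (insert v V)
  define \<sigma> :: "'i set \<Rightarrow> 'r" where "\<sigma> S = (-1) ^ (card V - card S)" for S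
  have sub: "finite S \<and> v \<notin> S \<and> card S \<le> card V" if "S \<in> Pow V" for S
    using that insert.hyps by (auto intro: finite_subset card_mono)
  have split: "Pow (insert v V) = Pow V \<union> insert v ` Pow V"
    by (rule Pow_insert)
  have disj: "Pow V \<inter> insert v ` Pow V = {}"
    using insert.hyps by auto
  have inj: "inj_on (insert v) (Pow V)"
    using insert.hyps by (intro inj_onI) (metis PowD insert_ident subsetD)
  have "(\<Sum>S\<in>Pow (insert v V). (-1) ^ (card (insert v V) - card S) * (\<Sum>j\<in>S. a j) ^ e) =
      (\<Sum>S\<in>Pow V. (-1) ^ (card (insert v V) - card S) * (\<Sum>j\<in>S. a j) ^ e) +
      (\<Sum>S\<in>Pow V. (-1) ^ (card (insert v V) - card (insert v S)) * (\<Sum>j\<in>insert v S. a j) ^ e)"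
    unfolding split using insert.hyps disj by (simp add: sum.union_disjoint sum.reindex[OF inj])
  also have "\<dots> = (\<Sum>S\<in>Pow V. \<sigma> S * ((\<Sum>j\<in>S. a j) + a v) ^ e - \<sigma> S * (\<Sum>j\<in>S. a j) ^ e)"
    unfolding sum.distrib[symmetric]
    by (intro sum.cong refl) (use sub insert.hyps in \<open>simp add: \<sigma>_def Suc_diff_le add.commute\<close>)
  also have "\<dots> = (\<Sum>S\<in>Pow V. \<Sum>l<e. of_nat (e choose l) * a v ^ (e - l) * (\<sigma> S * (\<Sum>j\<in>S. a j) ^ l))"
  proof (intro sum.cong refl)
    fix S
    have "((\<Sum>j\<in>S. a j) + a v) ^ e = (\<Sum>l<e. of_nat (e choose l) * (\<Sum>j\<in>S. a j) ^ l * a v ^ (e - l))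
        + (\<Sum>j\<in>S. a j) ^ e"
      by (simp add: binomial_ring flip: lessThan_Suc_atMost)
    then show "\<sigma> S * ((\<Sum>j\<in>S. a j) + a v) ^ e - \<sigma> S * (\<Sum>j\<in>S. a j) ^ e =
        (\<Sum>l<e. of_nat (e choose l) * a v ^ (e - l) * (\<sigma> S * (\<Sum>j\<in>S. a j) ^ l))"
      by (simp add: distrib_left sum_distrib_left ac_simps)
  qed
  also have "\<dots> = (\<Sum>l<e. of_nat (e choose l) * a v ^ (e - l) * (\<Sum>S\<in>Pow V. \<sigma> S * (\<Sum>j\<in>S. a j) ^ l))"
    by (subst sum.swap) (simp add: sum_distrib_left)
  also have "\<dots> = (\<Sum>l<e. if l = card V then of_nat (e choose l) * a v ^ (e - l) *
      (fact (card V) * (\<Prod>j\<in>V. a j)) else 0)"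
    by (intro sum.cong refl) (use insert in \<open>simp add: \<sigma>_def\<close>)
  also have "\<dots> = (if e = card (insert v V) then fact (card (insert v V)) * (\<Prod>j\<in>insert v V. a j)
      else 0)"
    using insert.prems insert.hyps by (auto simp: algebra_simps)
  finally show ?case .
qed

text \<open>Substituting \<open>x\<^sub>i \<mapsto> \<phi> b\<^sub>i\<close> with \<open>\<phi> = (\<Sum>j\<in>S. s\<^sub>j)\<close> into the identity \<open>f\<close> of \<open>C\<close> gives a
  polynomial in the scalar function \<open>\<phi>\<close>, which represents an identity of \<open>C\<close>. The alternating
  sum over \<open>S\<close> keeps only its top coefficient. In this way a single nonzero value of \<open>f\<close> already
  yields products of arbitrary scalar values.\<close>

lemma identity_values_polarized:
  fixes C :: "('f::field_char_0, ('f, 'n::finite) der, 'b::ab_group_add) lalg"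
    and s :: "nat \<Rightarrow> (nat \<Rightarrow> 'f^'n^'n) \<Rightarrow> 'f"
  assumes C: "is_L_algebra C" and f: "f \<in> L_identities C"
    and s: "\<And>j. j < D \<Longrightarrow> s j \<in> scalar_values"
    and line: "\<And>t. free_eval mat_lalg (\<lambda>i. mat_scale t (b0 i)) f = (\<Sum>d\<le>D. mat_scale (t ^ d) (a d))"
  shows "(\<lambda>b. mat_scale (\<Prod>j<D. s j b) (a D)) \<in> identity_values C"
proof -
  interpret mat: assoc_algebra "mat_scale :: 'f \<Rightarrow> 'f^'n^'n \<Rightarrow> _" "(**)"
    by (rule assoc_algebra_mat)
  have "(\<lambda>b. \<Sum>d\<le>D. mat_scale ((\<Sum>j\<in>S. s j b) ^ d) (a d)) \<in> identity_values C"
      if S: "S \<in> Pow {..<D}" for S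
  proof -
    \<comment> \<open>So \<open>\<phi> b\<^sub>i\<close> is the value of an element \<open>h\<^sub>i\<close> of the free algebra, which
      can be substituted for \<open>x\<^sub>i\<close>.\<close>
    have "(\<lambda>b. mat_scale (\<Sum>j\<in>S. s j b) B) \<in> generic_values" for B
      using S s unfolding mat.scale_sum_left
      by (intro sum_generic_values) (auto simp: scalar_values_def)
    then have "\<forall>i. \<exists>g. (\<lambda>b. mat_scale (\<Sum>j\<in>S. s j b) (b0 i)) = (\<lambda>b. free_eval mat_lalg b g)"
      unfolding generic_values_def image_iff by blast
    then obtain h where "\<forall>i. (\<lambda>b. mat_scale (\<Sum>j\<in>S. s j b) (b0 i)) = (\<lambda>b. free_eval mat_lalg b (h i))"
      by (rule choice[THEN exE])
    then have h: "free_eval mat_lalg b (h i) = mat_scale (\<Sum>j\<in>S. s j b) (b0 i)" for i b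
      by (simp add: fun_eq_iff)
    show ?thesis
      unfolding identity_values_def
    proof (rule image_eqI[of _ _ "free_eval free_L_algebra h f"])
      show "free_eval free_L_algebra h f \<in> L_identities C"
        using f by (simp add: L_identities_def free_eval_substitution[OF C])
    qed (simp add: free_eval_substitution[OF is_L_algebra_mat_lalg] h line)
  qed
  then have "(\<lambda>b. \<Sum>S\<in>Pow {..<D}. mat_scale ((-1) ^ (card {..<D} - card S))
      (\<Sum>d\<le>D. mat_scale ((\<Sum>j\<in>S. s j b) ^ d) (a d))) \<in> identity_values C"
    by (intro sum_identity_values[OF C, of "Pow {..<D}"] identity_values_closed(2)[OF C])
  moreover have "(\<Sum>S\<in>Pow {..<D}. mat_scale ((-1) ^ (card {..<D} - card S))
      (\<Sum>d\<le>D. mat_scale ((\<Sum>j\<in>S. s j b) ^ d) (a d))) = mat_scale (fact D)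
          (mat_scale (\<Prod>j<D. s j b) (a D))" for b
  proof -
    have "(\<Sum>S\<in>Pow {..<D}. mat_scale ((-1) ^ (card {..<D} - card S))
        (\<Sum>d\<le>D. mat_scale ((\<Sum>j\<in>S. s j b) ^ d) (a d))) =
      (\<Sum>d\<le>D. mat_scale (\<Sum>S\<in>Pow {..<D}. (-1) ^ (card {..<D} - card S) * (\<Sum>j\<in>S. s j b) ^ d) (a d))"
      unfolding mat.scale_sum_right mat.scale_sum_left mat.scale_scale by (rule sum.swap)
    also have "\<dots> = (\<Sum>d\<le>D. if d = D then mat_scale (fact D * (\<Prod>j<D. s j b)) (a D) else 0)"
      by (intro sum.cong refl, subst polarization) auto
    finally show ?thesis by simp
  qed
  ultimately have "(\<lambda>b. mat_scale (fact D) (mat_scale (\<Prod>j<D. s j b) (a D))) \<in> identity_values C"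
    by simp
  from identity_values_closed(2)[OF C this, of "1 / fact D"] show ?thesis
    by simp
qed

text \<open>If \<open>A\<close> has a nonzero entry at \<open>(i, j)\<close>, then \<open>E\<^sub>p\<^sub>i A E\<^sub>j\<^sub>q\<close> is a nonzero multiple of
  \<open>E\<^sub>p\<^sub>q\<close>. So two more scalar functions, realized on the left and on the right, replace the top
  coefficient of the preceding lemma by an arbitrary matrix.\<close>

lemma identity_values_products:
  fixes C :: "('f::field_char_0, ('f, 'n::finite) der, 'b::ab_group_add) lalg"
  assumes C: "is_L_algebra C" and f: "f \<in> L_identities C"
    and nonid: "f \<notin> L_identities (mat_lalg :: ('f, ('f, 'n) der, 'f^'n^'n) lalg)"
  obtains m :: nat where "m \<ge> 1"
    and "\<And>s B. (\<And>j. j < m \<Longrightarrow> s j \<in> scalar_values) \<Longrightarrow>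
      (\<lambda>b. mat_scale (\<Prod>j<m. s j b) B) \<in> identity_values C"
proof -
  interpret mat: assoc_algebra "mat_scale :: 'f \<Rightarrow> 'f^'n^'n \<Rightarrow> _" "(**)"
    by (rule assoc_algebra_mat)
  obtain b0 :: "nat \<Rightarrow> 'f^'n^'n" where b0: "free_eval mat_lalg b0 f \<noteq> 0"
    using nonid by (auto simp: L_identities_def)
  obtain a :: "nat \<Rightarrow> 'f^'n^'n" and D where a: "a D \<noteq> 0"
    and line: "\<And>t. free_eval mat_lalg (\<lambda>i. mat_scale t (b0 i)) f = (\<Sum>d\<le>D. mat_scale (t ^ d) (a d))"
    using free_eval_along_line[OF is_L_algebra_mat_lalg b0] unfolding mat_lalg_simps by blast
  obtain i j where ij: "a D $ i $ j \<noteq> 0"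
    using a by (auto simp: vec_eq_iff)
  show thesis
  proof (rule that)
    show "Suc (Suc D) \<ge> 1" by simp
    fix s :: "nat \<Rightarrow> (nat \<Rightarrow> 'f^'n^'n) \<Rightarrow> 'f" and B :: "'f^'n^'n"
    assume s: "\<And>j. j < Suc (Suc D) \<Longrightarrow> s j \<in> scalar_values"
    have gen: "(\<lambda>b. mat_scale (s j b) E) \<in> generic_values" if "j < Suc (Suc D)" for j E
      using s[OF that] by (simp add: scalar_values_def)
    have unit: "(\<lambda>b. mat_scale (\<Prod>j<Suc (Suc D). s j b) (unit_matrix p q)) \<in> identity_values C" for p q
    proof -
      have sandwich: "unit_matrix p i ** a D ** unit_matrix j q =
          mat_scale (a D $ i $ j) (unit_matrix p q)"
        by (auto simp: entrywise)
      have "(\<lambda>b. mat_scale (\<Prod>j<D. s j b) (a D)) \<in> identity_values C"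
        by (rule identity_values_polarized[OF C f s line]) auto
      then have "(\<lambda>b. mat_scale (s D b) (unit_matrix p i) ** mat_scale (\<Prod>j<D. s j b) (a D)) \<in>
          identity_values C"
        by (rule identity_values_closed(4)[OF C]) (simp add: gen)
      then have "(\<lambda>b. mat_scale (s D b) (unit_matrix p i) ** mat_scale (\<Prod>j<D. s j b) (a D) **
          mat_scale (s (Suc D) b) (unit_matrix j q)) \<in> identity_values C"
        by (rule identity_values_closed(3)[OF C]) (simp add: gen)
      from identity_values_closed(2)[OF C this, of "1 / a D $ i $ j"]
      show ?thesis
        using ij by (simp add: mat_algebra_simps sandwich ac_simps)
    qed
    have "mat_scale x B = (\<Sum>p\<in>UNIV. \<Sum>q\<in>UNIV. mat_scale (B $ p $ q)
        (mat_scale x (unit_matrix p q)))" for x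
      using matrix_by_units[of "mat_scale x B"] by (simp add: mat_scale_nth mult.commute)
    then show "(\<lambda>b. mat_scale (\<Prod>j<Suc (Suc D). s j b) B) \<in> identity_values C"
      by (simp only:) (intro sum_identity_values[OF C] identity_values_closed(2)[OF C] unit)
  qed
qed

text \<open>Two traceless coordinates form a scalar value, so \<open>2 m\<close> of them provide \<open>m\<close>; all further
  coordinates are absorbed into the first one.\<close>

lemma coord_product_factorization:
  fixes c :: "nat \<Rightarrow> ('n::finite \<times> 'n) option"
  assumes card: "CARD('n) \<ge> 2" and "m \<ge> 1"
    and "finite V" "2 * m \<le> card {i\<in>V. c i \<noteq> None}"
  shows "\<exists>s. (\<forall>j<m. s j \<in> scalar_values) \<and>
    (\<forall>b :: nat \<Rightarrow> 'f::field_char_0^'n^'n. (\<Prod>i\<in>V. coord (c i) (b i)) = (\<Prod>j<m. s j b))"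
  using assms(2-)
proof (induction m arbitrary: V rule: nat_induct_at_least)
  case (base V)
  obtain T where "T \<subseteq> {i\<in>V. c i \<noteq> None}" "card T = 2"
    using obtain_subset_with_card_n[of 2 "{i\<in>V. c i \<noteq> None}"] base by auto
  then obtain i j k l where ij: "i \<noteq> j" "i \<in> V" "j \<in> V" "c i = Some k" "c j = Some l"
    by (auto simp: card_2_iff)
  have "(\<lambda>b :: nat \<Rightarrow> 'f^'n^'n. (\<Prod>i\<in>W. coord (c i) (b i)) *
      (coord (Some k) (b i) * coord (Some l) (b j))) \<in> scalar_values"
    if "finite W" for W
    using that
  proof induction
    case (insert w W)
    from coord_times_scalar_value[OF card insert.IH, of "c w" w] insert.hyps show ?case
      by (simp add: mult.assoc)
  qed (use coord_pair_scalar_value[OF card, of k i l j] in simp)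
  from this[of "V - {i} - {j}"]
  have "(\<lambda>b :: nat \<Rightarrow> 'f^'n^'n. (\<Prod>i\<in>V. coord (c i) (b i))) \<in> scalar_values"
    using base(1) ij
    by (simp add: prod.remove[of V i] prod.remove[of "V - {i}" j] ac_simps del: coord.simps)
  then show ?case
    by (intro exI[of _ "\<lambda>_ b. \<Prod>i\<in>V. coord (c i) (b i)"]) simp
next
  case (Suc m V)
  obtain T where T: "T \<subseteq> {i\<in>V. c i \<noteq> None}" "card T = 2" "finite T"
    using obtain_subset_with_card_n[of 2 "{i\<in>V. c i \<noteq> None}"] Suc.prems by auto
  then obtain i j k l where ij: "i \<noteq> j" "i \<in> V" "j \<in> V" "c i = Some k" "c j = Some l" "T = {i, j}"
    by (auto simp: card_2_iff)
  have "{i'\<in>V - {i} - {j}. c i' \<noteq> None} = {i\<in>V. c i \<noteq> None} - T"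
    using ij by auto
  then have "2 * m \<le> card {i'\<in>V - {i} - {j}. c i' \<noteq> None}"
    using T Suc.prems by (simp add: card_Diff_subset)
  then obtain s where s: "\<And>j. j < m \<Longrightarrow> s j \<in> scalar_values"
    and prod: "\<And>b :: nat \<Rightarrow> 'f^'n^'n. (\<Prod>i\<in>V - {i} - {j}. coord (c i) (b i)) = (\<Prod>j<m. s j b)"
    using Suc.IH[of "V - {i} - {j}"] Suc.prems(1) by blast
  have "(\<lambda>b :: nat \<Rightarrow> 'f^'n^'n. coord (Some k) (b i) * coord (Some l) (b j)) \<in> scalar_values"
    by (rule coord_pair_scalar_value[OF card])
  moreover have "(\<Prod>i\<in>V. coord (c i) (b i)) =
      (\<Prod>j<m. s j b) * (coord (Some k) (b i) * coord (Some l) (b j))" for b :: "nat \<Rightarrow> 'f^'n^'n"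
    using Suc.prems(1) ij prod[of b]
    by (simp add: prod.remove[of V i] prod.remove[of "V - {i}" j] ac_simps del: coord.simps)
  ultimately show ?case
    using s by (intro exI[of _ "s(m := \<lambda>b. coord (Some k) (b i) * coord (Some l) (b j))"])
      (simp add: less_Suc_eq del: coord.simps)
qed

section \<open>Exponential growth for the matrix algebra\<close>

lemma nonempty_prod_matrix_zero:
  "0 \<in> set xs \<Longrightarrow> nonempty_prod (**) xs = (0 :: 'f::field^'n^'n)"
proof -
  have zero: "0 ** A = 0" "A ** 0 = 0" for A :: "'f^'n^'n"
    by (simp_all add: matrix_matrix_mult_def vec_eq_iff)
  show "0 \<in> set xs \<Longrightarrow> nonempty_prod (**) xs = (0 :: 'f::field^'n^'n)"
    by (induction xs rule: induct_list012) (auto simp: zero)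
qed

lemma nonempty_prod_matrix_row:
  assumes "xs \<noteq> []" "\<And>x j. x \<in> set xs \<Longrightarrow> x $ p $ j = (if j = p then 1 else 0 :: 'f::field)"
  shows "nonempty_prod (**) xs $ p $ p = (1 :: 'f)"
proof -
  have "nonempty_prod (**) xs $ p $ j = (if j = p then 1 else 0 :: 'f)" for j
    using assms
  proof (induction xs arbitrary: j rule: induct_list012)
    case (3 x y zs)
    then have "x $ p $ k = (if k = p then 1 else 0)" for k by simp
    then have "nonempty_prod (**) (x # y # zs) $ p $ j = nonempty_prod (**) (y # zs) $ p $ j"
      by (simp add: matrix_matrix_mult_def if_distrib[of "\<lambda>c. c * _"] cong: if_cong)
    then show ?case using 3 by simp
  qed auto
  then show ?thesis by simp
qed

lemma free_module: "module (free_scale :: 'f::field \<Rightarrow> ('f, 'n::finite) free_lalg \<Rightarrow> _)"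
proof -
  interpret assoc_algebra "free_scale :: 'f \<Rightarrow> ('f, 'n) free_lalg \<Rightarrow> _" "(*)"
    by (rule assoc_algebra_free)
  show ?thesis by (rule module_axioms)
qed

text \<open>Let \<open>u\<close> act as the projection onto the scalar matrices, so that \<open>1 - u\<close> projects onto the
  traceless ones. For a set \<open>S\<close> of indices, the monomial with exponents \<open>1 - u\<close> in \<open>S\<close> and \<open>u\<close>
  elsewhere does not vanish when a fixed traceless, non-nilpotent matrix is substituted at the
  indices in \<open>T\<close> and the identity at the others if and only if \<open>S = T\<close>. Hence these \<open>2 ^ n\<close>
  monomials are linearly independent.\<close>

lemma exponential_codim_mat:
  assumes card: "CARD('n::finite) \<ge> 2" and n: "n \<ge> 1"
  shows "enat (2 ^ n) \<le> L_codim (mat_lalg :: ('f::field_char_0, ('f, 'n) der, 'f^'n^'n) lalg) n"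
proof -
  note ea = env_action_simps[OF is_L_algebra_mat_lalg, unfolded mat_lalg_simps]
  obtain p q :: 'n where pq: "p \<noteq> q"
    using card by (metis card_2_iff' obtain_subset_with_card_n)
  define d :: "'f^'n^'n" where "d = unit_matrix p p - unit_matrix q q"
  obtain u :: "('f, 'n) env" where u: "\<And>x. env_action mat_lalg u x =
      mat_scale (normalized_trace x) (mat 1)"
    using tensor_env_map_trace[where 'f = 'f and 'n = 'n] unfolding tensor_env_map_def env_maps_def
    by (auto simp: fun_eq_iff)
  have u': "env_action mat_lalg (1 - u) x = x - mat_scale (normalized_trace x) (mat 1)" for x
    using ea(3)[of "1 - u" u x] by (simp add: ea u eq_diff_eq)
  have trace: "normalized_trace d = 0" "normalized_trace (mat 1 :: 'f^'n^'n) = 1"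
    by (simp_all add: normalized_trace_def d_def unit_matrix_nth sum_subtractf mat_def)
  define w where "w S = free_monom (map (\<lambda>j. (j, if j \<in> S then 1 - u else u)) [0..<n])" for S
  define b where "b T i = (if i \<in> T then d else mat 1)" for T and i :: nat
  have eval: "free_eval mat_lalg (b T) (w S) = nonempty_prod (**)
      (map (\<lambda>j. if j \<in> S then if j \<in> T then d else 0 else if j \<in> T then 0 else mat 1) [0..<n])" for S T
  proof -
    have "mat_scale 0 (mat 1) = (0 :: 'f^'n^'n)" "mat_scale 1 (mat 1) = (mat 1 :: 'f^'n^'n)"
      by (simp_all add: vec_eq_iff mat_scale_nth)
    then show ?thesis
      unfolding w_def free_eval_monom[OF is_L_algebra_mat_lalg] mat_lalg_simps
      by (intro arg_cong[of _ _ "nonempty_prod (**)"]) (auto simp: u u' trace b_def)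
  qed
  have off: "free_eval mat_lalg (b T) (w S) = 0" if ne: "S \<noteq> T" and sub: "S \<subseteq> {..<n}" "T \<subseteq> {..<n}"
      for S T
  proof -
    obtain j where "j < n" "j \<in> S \<longleftrightarrow> j \<notin> T" using ne sub by blast
    then show ?thesis
      unfolding eval by (intro nonempty_prod_matrix_zero) (auto simp: image_iff intro!: bexI[of _ j])
  qed
  have on: "free_eval mat_lalg (b S) (w S) $ p $ p = 1" for S
    unfolding eval using n pq
    by (intro nonempty_prod_matrix_row) (auto simp: d_def unit_matrix_nth mat_def split: if_splits)
  have inj: "inj_on w (Pow {..<n})"
  proof (rule inj_onI, rule ccontr)
    fix S T assume *: "S \<in> Pow {..<n}" "T \<in> Pow {..<n}" "w S = w T" "S \<noteq> T"
    then have "free_eval mat_lalg (b T) (w T) = 0" using off[of S T] by simp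
    then show False using on[of T] by simp
  qed
  have "\<forall>v\<in>w ` Pow {..<n}. a v = 0"
    if a: "(\<Sum>v\<in>w ` Pow {..<n}. free_scale (a v) v) \<in> L_identities
        (mat_lalg :: ('f, ('f, 'n) der, 'f^'n^'n) lalg)" for a
  proof clarify
    fix T assume T: "T \<subseteq> {..<n}"
    have "0 = free_eval mat_lalg (b T) (\<Sum>v\<in>w ` Pow {..<n}. free_scale (a v) v)"
      using a by (simp add: L_identities_def)
    also have "\<dots> = (\<Sum>S\<in>Pow {..<n}. mat_scale (a (w S)) (free_eval mat_lalg (b T) (w S)))"
      by (simp add: free_eval_sum[OF is_L_algebra_mat_lalg] free_eval_mat_simps sum.reindex[OF inj])
    also have "\<dots> = (\<Sum>S\<in>Pow {..<n}. if S = T then mat_scale (a (w T))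
        (free_eval mat_lalg (b T) (w T)) else 0)"
      by (intro sum.cong refl) (use T off in \<open>auto simp: mat_algebra_simps\<close>)
    also have "\<dots> = mat_scale (a (w T)) (free_eval mat_lalg (b T) (w T))"
      using T by simp
    finally have "mat_scale (a (w T)) (free_eval mat_lalg (b T) (w T)) $ p $ p = 0" by simp
    then show "a (w T) = 0" by (simp add: mat_scale_nth on)
  qed
  moreover have "w ` Pow {..<n} \<subseteq> multilinear_part n"
  proof clarify
    fix S :: "nat set"
    show "w S \<in> multilinear_part n"
      unfolding multilinear_part_def w_def
      by (rule module.span_base[OF free_module])
          (rule CollectI, intro exI[of _ id] exI conjI permutes_id, simp)
  qed
  ultimately have "enat (card (w ` Pow {..<n})) \<le> L_codim
      (mat_lalg :: ('f, ('f, 'n) der, 'f^'n^'n) lalg) n"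
    unfolding L_codim_def quotient_dim_def by (intro SUP_upper) auto
  then show ?thesis
    by (simp add: card_image[OF inj] card_Pow)
qed

lemma not_polynomially_bounded_exponential:
  assumes "\<And>n. n \<ge> 1 \<Longrightarrow> enat (2 ^ n) \<le> c n"
  shows "\<not> polynomially_bounded c"
proof
  assume "polynomially_bounded c"
  then obtain \<alpha> t where \<alpha>: "\<alpha> > 0" "t > 0"
    and bound: "\<And>n. n \<ge> 1 \<Longrightarrow> \<exists>m. c n = enat m \<and> real m \<le> \<alpha> * real n powr t"
    unfolding polynomially_bounded_def by blast
  have "eventually (\<lambda>n. \<alpha> * real n powr t < 2 ^ n) at_top"
    using \<alpha> by real_asymp
  from eventually_conj[OF eventually_ge_at_top[of "1 :: nat"] this]
  obtain n where n: "n \<ge> 1" "\<alpha> * real n powr t < 2 ^ n"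
    by (metis (mono_tags, lifting) eventually_happens trivial_limit_sequentially)
  then obtain m where "c n = enat m" "real m \<le> \<alpha> * real n powr t"
    using bound by blast
  moreover from this have "2 ^ n \<le> m"
    using assms[OF n(1)] by simp
  then have "(2 :: real) ^ n \<le> real m"
    by (metis of_nat_le_iff of_nat_numeral of_nat_power)
  ultimately show False using n(2) by linarith
qed

section \<open>Polynomial growth of proper subvarieties\<close>

definition coord_linear_at :: "nat \<Rightarrow> ((nat \<Rightarrow> 'f::field^'n^'n) \<Rightarrow> 'f^'n^'n) \<Rightarrow> bool" where
  "coord_linear_at i F \<longleftrightarrow>
     (\<forall>b. F b = (\<Sum>k\<in>UNIV. mat_scale (coord k (b i)) (F (b(i := coord_matrix k)))))"

lemma nonempty_prod_linear_factor:
  fixes xs ys :: "('f::field^'n^'n) list"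
  shows "nonempty_prod (**) (xs @ (\<Sum>k\<in>K. mat_scale (t k) (y k)) # ys) =
    (\<Sum>k\<in>K. mat_scale (t k) (nonempty_prod (**) (xs @ y k # ys)))"
proof -
  define L where "L x = nonempty_prod (**) (xs @ x # ys)" for x
  have "L (x + y) = L x + L y \<and> L (mat_scale c x) = mat_scale c (L x)" for x y c
    unfolding L_def
  proof (induction xs)
    case Nil
    then show ?case by (cases ys) (simp_all add: mat_algebra_simps)
  next
    case (Cons z zs)
    have "nonempty_prod (**) ((z # zs) @ x # ys) = z ** nonempty_prod (**) (zs @ x # ys)" for x
      by (cases zs) simp_all
    then show ?case using Cons by (simp only:) (simp add: mat_algebra_simps)
  qed
  moreover from this have "L 0 = 0"
    by (metis add_cancel_right_right)
  ultimately have "L (\<Sum>k\<in>K. mat_scale (t k) (y k)) = (\<Sum>k\<in>K. mat_scale (t k) (L (y k)))"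
    by (induction K rule: infinite_finite_induct) simp_all
  then show ?thesis by (simp add: L_def)
qed

text \<open>Both sides of the expansion are linear in \<open>g\<close>, so \<open>g\<close> may be taken to be a monomial. In a
  multilinear monomial the variable \<open>x\<^sub>i\<close> occurs in exactly one factor.\<close>

lemma coord_linear_at_multilinear:
  fixes g :: "('f::field, 'n::finite) free_lalg"
  assumes g: "g \<in> multilinear_part n" and i: "i < n"
  shows "coord_linear_at i (\<lambda>b. free_eval mat_lalg b g)"
proof -
  interpret mat: assoc_algebra "mat_scale :: 'f \<Rightarrow> 'f^'n^'n \<Rightarrow> _" "(**)"
    by (rule assoc_algebra_mat)
  note ea = env_action_simps[OF is_L_algebra_mat_lalg, unfolded mat_lalg_simps]
  show ?thesis
    using g unfolding multilinear_part_def
  proof (induction rule: module.span_induct_alt[OF free_module, consumes 1])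
    case 1
    then show ?case
      by (simp add: coord_linear_at_def free_eval_zero[OF is_L_algebra_mat_lalg])
  next
    case (2 c m g)
    obtain \<sigma> and u :: "nat \<Rightarrow> ('f, 'n) env" where \<sigma>: "\<sigma> permutes {..<n}"
      and m: "m = free_monom (map (\<lambda>j. (\<sigma> j, u j)) [0..<n])"
      using 2(1) by blast
    obtain j where j: "j < n" "\<sigma> j = i"
      using i permutes_image[OF \<sigma>] by (metis imageE lessThan_iff)
    have other: "\<sigma> k \<noteq> i" if "k \<noteq> j" for k
      using that j(2) permutes_inj[OF \<sigma>] by (metis injD)
    have split: "[0..<n] = [0..<j] @ j # [Suc j..<n]"
      using j(1) by (metis less_imp_add_positive upt_add_eq_append upt_conv_Cons zero_le
          le_add_same_cancel1)
    define A where "A k b = env_action mat_lalg (u k) (b (\<sigma> k))" for k and b :: "nat \<Rightarrow> 'f^'n^'n"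
    have eval: "free_eval mat_lalg b m =
        nonempty_prod (**) (map (\<lambda>k. A k b) [0..<j] @ A j b # map (\<lambda>k. A k b) [Suc j..<n])" for b
      by (simp add: m free_eval_monom[OF is_L_algebra_mat_lalg] mat_lalg_simps split A_def o_def)
    have factor: "A j b = (\<Sum>k\<in>UNIV. mat_scale (coord k (b i)) (A j (b(i := coord_matrix k))))" for b
    proof -
      interpret additive "env_action mat_lalg (u j) :: 'f^'n^'n \<Rightarrow> _"
        by unfold_locales (simp add: ea)
      have "A j b = env_action mat_lalg (u j) (\<Sum>k\<in>UNIV. mat_scale (coord k (b i)) (coord_matrix k))"
        by (simp add: A_def j matrix_by_coord)
      then show ?thesis by (simp add: sum ea A_def j)
    qed
    have "A k (b(i := x)) = A k b" if "k \<noteq> j" for k b x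
      using other[OF that] by (simp add: A_def)
    then have "map (\<lambda>k. A k (b(i := x))) [0..<j] = map (\<lambda>k. A k b) [0..<j]"
      "map (\<lambda>k. A k (b(i := x))) [Suc j..<n] = map (\<lambda>k. A k b) [Suc j..<n]" for b x
      by auto
    note others = this
    have m_eq: "free_eval mat_lalg b m =
        (\<Sum>k\<in>UNIV. mat_scale (coord k (b i)) (free_eval mat_lalg (b(i := coord_matrix k)) m))" for b
      unfolding eval others by (subst factor) (rule nonempty_prod_linear_factor)
    show ?case
      unfolding coord_linear_at_def free_eval_mat_simps
    proof
      fix b
      have g_eq: "free_eval mat_lalg b g =
          (\<Sum>k\<in>UNIV. mat_scale (coord k (b i)) (free_eval mat_lalg (b(i := coord_matrix k)) g))"
        using 2(2) unfolding coord_linear_at_def by (rule spec)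
      have "mat_scale c (free_eval mat_lalg b m) + free_eval mat_lalg b g =
          mat_scale c (\<Sum>k\<in>UNIV. mat_scale (coord k (b i))
              (free_eval mat_lalg (b(i := coord_matrix k)) m)) +
          (\<Sum>k\<in>UNIV. mat_scale (coord k (b i)) (free_eval mat_lalg (b(i := coord_matrix k)) g))"
        by (intro arg_cong2[of _ _ _ _ "(+)"] arg_cong[of _ _ "mat_scale c"] m_eq g_eq)
      also have "\<dots> = (\<Sum>k\<in>UNIV. mat_scale (coord k (b i))
          (mat_scale c (free_eval mat_lalg (b(i := coord_matrix k)) m) +
           free_eval mat_lalg (b(i := coord_matrix k)) g))"
        by (simp add: mat.scale_sum_right mat_algebra_simps sum.distrib mult.commute)
      finally show "mat_scale c (free_eval mat_lalg b m) + free_eval mat_lalg b g = \<dots>" .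
    qed
  qed
qed

lemma free_eval_multilinear_cong:
  fixes g :: "('f::field, 'n::finite) free_lalg"
  assumes g: "g \<in> multilinear_part n" and b: "\<And>i. i < n \<Longrightarrow> b i = b' i"
  shows "free_eval mat_lalg b g = free_eval mat_lalg b' g"
  using g unfolding multilinear_part_def
proof (induction rule: module.span_induct_alt[OF free_module, consumes 1])
  case 1
  then show ?case by (simp add: free_eval_zero[OF is_L_algebra_mat_lalg])
next
  case (2 c m g)
  obtain \<sigma> and u :: "nat \<Rightarrow> ('f, 'n) env" where \<sigma>: "\<sigma> permutes {..<n}"
    and m: "m = free_monom (map (\<lambda>j. (\<sigma> j, u j)) [0..<n])"
    using 2(1) by blast
  have "\<sigma> j < n" if "j < n" for j
    using that permutes_in_image[OF \<sigma>] by simp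
  then have "free_eval mat_lalg b m = free_eval mat_lalg b' m"
    unfolding m free_eval_monom[OF is_L_algebra_mat_lalg]
    by (intro arg_cong[of _ _ "nonempty_prod _"]) (simp add: b)
  then show ?case using 2(2) by (simp add: free_eval_mat_simps)
qed

lemma multilinear_coord_expansion:
  fixes F :: "(nat \<Rightarrow> 'f::field^'n^'n) \<Rightarrow> 'f^'n^'n"
  assumes "finite V" "\<And>i. i \<in> V \<Longrightarrow> coord_linear_at i F"
  shows "F b = (\<Sum>c\<in>PiE V (\<lambda>_. UNIV). mat_scale (\<Prod>i\<in>V. coord (c i) (b i))
    (F (\<lambda>i. if i \<in> V then coord_matrix (c i) else b i)))"
  using assms
proof (induction V)
  case empty
  have "mat_scale 1 (F b) = F b" by (simp add: vec_eq_iff mat_scale_nth)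
  then show ?case by simp
next
  case (insert v V)
  interpret mat: assoc_algebra "mat_scale :: 'f \<Rightarrow> 'f^'n^'n \<Rightarrow> _" "(**)"
    by (rule assoc_algebra_mat)
  have inj: "inj_on (\<lambda>(y, g). g(v := y)) (UNIV \<times> PiE V (\<lambda>_. UNIV :: ('n \<times> 'n) option set))"
    using inj_combinator[OF insert.hyps(2), of "\<lambda>_. UNIV"] by simp
  have step: "F (\<lambda>i. if i \<in> V then coord_matrix (c i) else b i) =
      (\<Sum>k\<in>UNIV. mat_scale (coord k (b v))
        (F (\<lambda>i. if i \<in> insert v V then coord_matrix ((c(v := k)) i) else b i)))" for c
  proof -
    define b' where "b' i = (if i \<in> V then coord_matrix (c i) else b i)" for i
    have b': "b'(v := coord_matrix k) =
      (\<lambda>i. if i \<in> insert v V then coord_matrix ((c(v := k)) i) else b i)" for k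
      using insert.hyps by (auto simp: b'_def)
    have "F b' = (\<Sum>k\<in>UNIV. mat_scale (coord k (b' v)) (F (b'(v := coord_matrix k))))"
      using insert.prems[of v] unfolding coord_linear_at_def by blast
    moreover have "b' v = b v"
      using insert.hyps(2) by (simp add: b'_def)
    ultimately show ?thesis
      unfolding b' by (simp only: b'_def[abs_def])
  qed
  have prod: "(\<Prod>i\<in>insert v V. coord ((c(v := k)) i) (b i)) =
      coord k (b v) * (\<Prod>i\<in>V. coord (c i) (b i))" for c k
    using insert.hyps by (simp, intro disjI2 prod.cong) auto
  have "F b = (\<Sum>c\<in>PiE V (\<lambda>_. UNIV). mat_scale (\<Prod>i\<in>V. coord (c i) (b i))
    (F (\<lambda>i. if i \<in> V then coord_matrix (c i) else b i)))"
    using insert by blast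
  also have "\<dots> = (\<Sum>c\<in>PiE V (\<lambda>_. UNIV). \<Sum>k\<in>UNIV. mat_scale (\<Prod>i\<in>insert v V. coord ((c(v := k)) i) (b i))
        (F (\<lambda>i. if i \<in> insert v V then coord_matrix ((c(v := k)) i) else b i)))"
    unfolding step prod by (simp add: mat.scale_sum_right mult.commute)
  also have "\<dots> = (\<Sum>(k, c)\<in>UNIV \<times> PiE V (\<lambda>_. UNIV).
      mat_scale (\<Prod>i\<in>insert v V. coord ((c(v := k)) i) (b i))
        (F (\<lambda>i. if i \<in> insert v V then coord_matrix ((c(v := k)) i) else b i)))"
    by (subst sum.swap) (rule sum.cartesian_product)
  also have "\<dots> = (\<Sum>c\<in>PiE (insert v V) (\<lambda>_. UNIV). mat_scale (\<Prod>i\<in>insert v V. coord (c i) (b i))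
        (F (\<lambda>i. if i \<in> insert v V then coord_matrix (c i) else b i)))"
    unfolding PiE_insert_eq sum.reindex[OF inj] by (simp add: split_def o_def)
  finally show ?case .
qed

lemma more_vectors_than_coordinates:
  fixes coef :: "'v \<Rightarrow> 'i \<Rightarrow> 'f::field"
  assumes "finite I" "finite S" "card I < card S"
  shows "\<exists>a. (\<exists>v\<in>S. a v \<noteq> 0) \<and> (\<forall>i\<in>I. (\<Sum>v\<in>S. a v * coef v i) = 0)"
  using assms
proof (induction I arbitrary: S coef)
  case empty
  then show ?case by (intro exI[of _ "\<lambda>_. 1"]) (auto simp: card_gt_0_iff)
next
  case (insert i I)
  show ?case
  proof (cases "\<forall>v\<in>S. coef v i = 0")
    case True
    then show ?thesis using insert.IH[of S coef] insert.prems insert.hyps by auto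
  next
    case False
    then obtain w where w: "w \<in> S" "coef w i \<noteq> 0" by blast
    have "finite (S - {w})" "card I < card (S - {w})"
      using insert.prems insert.hyps w by auto
    from insert.IH[OF this, of "\<lambda>v j. coef v j - coef v i / coef w i * coef w j"]
    obtain a where a: "\<exists>v\<in>S - {w}. a v \<noteq> 0"
      "\<And>j. j \<in> I \<Longrightarrow> (\<Sum>v\<in>S - {w}. a v * (coef v j - coef v i / coef w i * coef w j)) = 0"
      by blast
    define a' where "a' = a(w := - (\<Sum>v\<in>S - {w}. a v * coef v i) / coef w i)"
    have split: "(\<Sum>v\<in>S. a' v * coef v j) =
        - (\<Sum>v\<in>S - {w}. a v * coef v i) / coef w i * coef w j + (\<Sum>v\<in>S - {w}. a v * coef v j)" for j
    proof -
      have "(\<Sum>v\<in>S - {w}. a' v * coef v j) = (\<Sum>v\<in>S - {w}. a v * coef v j)"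
        by (intro sum.cong) (auto simp: a'_def)
      then show ?thesis
        using insert.prems w by (simp add: sum.remove[of S w] a'_def)
    qed
    have "(\<Sum>v\<in>S. a' v * coef v j) = 0" if "j \<in> insert i I" for j
    proof (cases "j = i")
      case True
      then show ?thesis using w by (simp add: split)
    next
      case False
      then have "(\<Sum>v\<in>S - {w}. a v * coef v j - a v * coef v i / coef w i * coef w j) = 0"
        using that a(2)[of j] by (simp add: algebra_simps)
      then show ?thesis
        by (simp add: split sum_subtractf flip: sum_distrib_right sum_divide_distrib)
    qed
    moreover have "\<exists>v\<in>S. a' v \<noteq> 0" using a(1) by (auto simp: a'_def)
    ultimately show ?thesis by blast
  qed
qed

text \<open>A function with fewer than \<open>N\<close> values different from \<open>None\<close> is recovered from a list of
  \<open>N\<close> points of its graph.\<close>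

lemma card_sparse_functions:
  assumes "n \<ge> 1"
  shows "finite {c \<in> PiE {..<n} (\<lambda>_. UNIV :: 'a::finite option set). card {i\<in>{..<n}. c i \<noteq> None} < N}"
    and "card {c \<in> PiE {..<n} (\<lambda>_. UNIV :: 'a::finite option set). card {i\<in>{..<n}. c i \<noteq> None} < N}
      \<le> (n * CARD('a option)) ^ N"
proof -
  let ?C = "{c \<in> PiE {..<n} (\<lambda>_. UNIV :: 'a option set). card {i\<in>{..<n}. c i \<noteq> None} < N}"
  let ?L = "{xs. set xs \<subseteq> {..<n} \<times> (UNIV :: 'a option set) \<and> length xs = N}"
  define \<Phi> where "\<Phi> xs = restrict (\<lambda>i. case map_of xs i of None \<Rightarrow> None | Some k \<Rightarrow> k) {..<n}"
    for xs :: "(nat \<times> 'a option) list"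
  have L: "finite ?L" "card ?L = (n * CARD('a option)) ^ N"
    using finite_lists_length_eq[of "{..<n} \<times> (UNIV :: 'a option set)" N]
      card_lists_length_eq[of "{..<n} \<times> (UNIV :: 'a option set)" N]
    by (simp_all add: card_cartesian_product del: card_option)
  have sub: "?C \<subseteq> \<Phi> ` ?L"
  proof
    fix c assume c: "c \<in> ?C"
    define T where "T = {i\<in>{..<n}. c i \<noteq> None}"
    obtain ys where ys: "set ys = T" "distinct ys"
      using finite_distinct_list[of T] unfolding T_def by auto
    have len: "length ys < N"
      using c ys distinct_card[OF ys(2)] by (simp add: T_def)
    \<comment> \<open>The list is padded to length \<open>N\<close> with the point over \<open>0\<close>, which exists as
      \<open>n \<ge> 1\<close>.\<close>
    define xs where "xs = map (\<lambda>i. (i, c i)) (ys @ replicate (N - length ys) 0)"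
    have mem: "snd x = c (fst x)" if "x \<in> set xs" for x
      using that by (auto simp: xs_def)
    have "xs \<in> ?L"
      using ys len assms by (auto simp: xs_def T_def)
    moreover have "\<Phi> xs = c"
    proof
      fix i
      show "\<Phi> xs i = c i"
      proof (cases "i < n")
        case False
        then have "c i = undefined" using c PiE_arb[of c "{..<n}" "\<lambda>_. UNIV" i] by simp
        then show ?thesis using False by (simp add: \<Phi>_def)
      next
        case True
        show ?thesis
        proof (cases "map_of xs i")
          case None
          then have "i \<notin> T" using ys by (force simp: map_of_eq_None_iff xs_def image_image)
          then show ?thesis using True None by (auto simp: \<Phi>_def T_def)
        next
          case (Some k)
          then have "k = c i" using mem[of "(i, k)"] map_of_SomeD by fastforce
          then show ?thesis using True Some by (simp add: \<Phi>_def)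
        qed
      qed
    qed
    ultimately show "c \<in> \<Phi> ` ?L" by blast
  qed
  show "finite ?C" by (rule finite_subset[OF sub]) (use L in simp)
  show "card ?C \<le> (n * CARD('a option)) ^ N"
    using card_mono[OF finite_imageI[OF L(1)] sub] card_image_le[OF L(1), of \<Phi>] L(2) by simp
qed

text \<open>Expand a multilinear \<open>g\<close> in coordinates, one term for each assignment \<open>c\<close> of coordinates
  to the \<open>n\<close> variables. A term in which \<open>c\<close> picks at least \<open>2 m\<close> traceless coordinates is a
  product of \<open>m\<close> scalar values times a matrix, so it comes from an identity of \<open>C\<close>. The
  remaining assignments are polynomially many, and \<open>g\<close> is an identity of \<open>C\<close> as soon as its
  values at the matrices that correspond to them vanish. More elements than there are entries of
  these values admit a nontrivial combination that vanishes at all of them.\<close>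

lemma codim_bound:
  fixes C :: "('f::field_char_0, ('f, 'n::finite) der, 'b::ab_group_add) lalg"
    and M :: "('f, ('f, 'n) der, 'f^'n^'n) lalg"
  assumes card: "CARD('n) \<ge> 2" and C: "is_L_algebra C" and M: "M = mat_lalg"
    and sub: "L_identities M \<subseteq> L_identities C"
    and nonid: "f \<in> L_identities C" "f \<notin> L_identities M"
  obtains N where "\<And>n. n \<ge> 1 \<Longrightarrow>
    L_codim C n \<le> enat ((n * CARD(('n \<times> 'n) option)) ^ N * CARD('n \<times> 'n))"
proof -
  obtain m where m: "m \<ge> 1"
    and products: "\<And>(s :: nat \<Rightarrow> (nat \<Rightarrow> 'f^'n^'n) \<Rightarrow> 'f) B. (\<And>j. j < m \<Longrightarrow> s j \<in> scalar_values) \<Longrightarrow>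
      (\<lambda>b. mat_scale (\<Prod>j<m. s j b) B) \<in> identity_values C"
    using identity_values_products[OF C nonid(1)] nonid(2) unfolding M by blast
  have "L_codim C n \<le> enat ((n * CARD(('n \<times> 'n) option)) ^ (2 * m) * CARD('n \<times> 'n))" if n: "n \<ge> 1"
      for n
  proof -
    define E where "E = PiE {..<n} (\<lambda>_. UNIV :: ('n \<times> 'n) option set)"
    define K where "K = {c\<in>E. card {i\<in>{..<n}. c i \<noteq> None} < 2 * m}"
    note K = card_sparse_functions[OF n, of "2 * m", where 'a = "'n \<times> 'n", folded E_def, folded K_def]
    have finE: "finite E" unfolding E_def by (intro finite_PiE) auto
    have "card S \<le> card (K \<times> (UNIV :: ('n \<times> 'n) set))"
      if S: "finite S" "S \<subseteq> multilinear_part n"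
        and indep: "\<And>a. (\<Sum>v\<in>S. free_scale (a v) v) \<in> multilinear_part n \<inter> L_identities C \<Longrightarrow>
            \<forall>v\<in>S. a v = 0"
      for S :: "('f, 'n) free_lalg set"
    proof (rule ccontr)
      \<comment> \<open>The value outside \<open>{..<n}\<close> is arbitrary: \<open>g\<close> involves only the first \<open>n\<close>
        variables.\<close>
      define pt where "pt c i = (if i \<in> {..<n} then coord_matrix (c i) else 0 :: 'f^'n^'n)"
        for c :: "nat \<Rightarrow> ('n \<times> 'n) option" and i
      assume "\<not> card S \<le> card (K \<times> (UNIV :: ('n \<times> 'n) set))"
      then obtain a where a: "\<exists>v\<in>S. a v \<noteq> 0"
        "\<And>c p q. c \<in> K \<Longrightarrow> (\<Sum>v\<in>S. a v * free_eval mat_lalg (pt c) v $ p $ q) = 0"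
        using more_vectors_than_coordinates[of "K \<times> (UNIV :: ('n \<times> 'n) set)" S
          "\<lambda>v (c, p, q). free_eval mat_lalg (pt c) v $ p $ q"] K(1) S(1) by fastforce
      define g where "g = (\<Sum>v\<in>S. free_scale (a v) v)"
      have gP: "g \<in> multilinear_part n"
        using S(2) unfolding g_def multilinear_part_def
        by (intro module.span_sum[OF free_module] module.span_scale[OF free_module]) auto
      have sparse: "free_eval mat_lalg (pt c) g = 0" if "c \<in> K" for c
        using a(2)[OF that] by (simp add: g_def free_eval_sum[OF is_L_algebra_mat_lalg]
            free_eval_mat_simps vec_eq_iff mat_scale_nth)
      have "(\<lambda>b. free_eval mat_lalg b g) \<in> identity_values C"
      proof -
        have "(\<lambda>b. mat_scale (\<Prod>i<n. coord (c i) (b i)) B) \<in> identity_values C"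
          if c: "c \<in> E - K" for c B
        proof -
          have "2 * m \<le> card {i\<in>{..<n}. c i \<noteq> None}" using c by (auto simp: K_def)
          from coord_product_factorization[OF card m finite_lessThan this]
          obtain s where "\<And>j. j < m \<Longrightarrow> s j \<in> scalar_values"
            "\<And>b :: nat \<Rightarrow> 'f^'n^'n. (\<Prod>i<n. coord (c i) (b i)) = (\<Prod>j<m. s j b)" by blast
          then show ?thesis using products[of s B] by simp
        qed
        then have sum: "(\<lambda>b. \<Sum>c\<in>E - K. mat_scale (\<Prod>i<n. coord (c i) (b i))
            (free_eval mat_lalg (pt c) g))
            \<in> identity_values C"
          by (rule sum_identity_values[OF C])
        have "(\<lambda>b. free_eval mat_lalg b g) =
            (\<lambda>b. \<Sum>c\<in>E - K. mat_scale (\<Prod>i<n. coord (c i) (b i)) (free_eval mat_lalg (pt c) g))"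
        proof
          fix b
          have "free_eval mat_lalg b g = free_eval mat_lalg (\<lambda>i. if i < n then b i else 0) g"
            by (rule free_eval_multilinear_cong[OF gP]) simp
          also have "\<dots> = (\<Sum>c\<in>E. mat_scale (\<Prod>i<n. coord (c i) (if i < n then b i else 0))
              (free_eval mat_lalg (\<lambda>i. if i \<in> {..<n} then coord_matrix (c i) else
                  if i < n then b i else 0) g))"
            unfolding E_def
            by (rule multilinear_coord_expansion) (auto intro: coord_linear_at_multilinear[OF gP])
          also have "\<dots> = (\<Sum>c\<in>E. mat_scale (\<Prod>i<n. coord (c i) (b i)) (free_eval mat_lalg (pt c) g))"
          proof (intro sum.cong refl arg_cong2[of _ _ _ _ mat_scale])
            fix c
            show "free_eval mat_lalg (\<lambda>i.
                if i \<in> {..<n} then coord_matrix (c i) else if i < n then b i else 0) g =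
                free_eval mat_lalg (pt c) g"
              by (rule free_eval_multilinear_cong[OF gP]) (simp add: pt_def)
          qed simp
          also have "\<dots> = (\<Sum>c\<in>E - K. mat_scale (\<Prod>i<n. coord (c i) (b i)) (free_eval mat_lalg (pt c) g))"
            using finE sparse by (intro sum.mono_neutral_right) (auto simp: mat_algebra_simps)
          finally show "free_eval mat_lalg b g = \<dots>" .
        qed
        then show ?thesis by (rule ssubst) (rule sum)
      qed
      then obtain h where h: "h \<in> L_identities C"
        "(\<lambda>b. free_eval mat_lalg b g) = (\<lambda>b. free_eval mat_lalg b h)"
        unfolding identity_values_def by blast
      have "g - h \<in> L_identities M"
        using fun_cong[OF h(2)] by (simp add: M L_identities_def
            free_eval_minus[OF is_L_algebra_mat_lalg])
      then have "g \<in> L_identities C"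
        using sub h(1) by (auto simp: L_identities_def free_eval_minus[OF C])
      then show False using indep[of a] gP a(1) by (auto simp: g_def)
    qed
    moreover have "card (K \<times> (UNIV :: ('n \<times> 'n) set)) \<le> (n * CARD(('n \<times> 'n) option)) ^ (2 * m) *
        CARD('n \<times> 'n)"
      using K(2) by (simp only: card_cartesian_product) (rule mult_right_mono, auto)
    ultimately show ?thesis
      unfolding L_codim_def quotient_dim_def by (intro SUP_least) force
  qed
  then show thesis by (rule that)
qed

lemma polynomially_boundedI:
  assumes "\<And>n. n \<ge> 1 \<Longrightarrow> c n \<le> enat ((n * k) ^ N * l)"
  shows "polynomially_bounded c"
  unfolding polynomially_bounded_def
proof (rule exI[of _ "real (k ^ N * l + 1)"], rule exI[of _ "real (N + 1)"], intro conjI allI impI)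
  show "real (k ^ N * l + 1) > 0" "real (N + 1) > 0" by (simp_all only: of_nat_0_less_iff)
  fix n :: nat assume n: "n \<ge> 1"
  obtain m where m: "c n = enat m" "m \<le> (n * k) ^ N * l"
    using assms[OF n] by (cases "c n") auto
  have "real m \<le> real (k ^ N * l) * real n ^ N"
    using m(2) by (metis (no_types, lifting) mult.assoc mult.commute of_nat_le_iff of_nat_mult
        of_nat_power power_mult_distrib)
  also have "\<dots> \<le> real (k ^ N * l + 1) * real n ^ (N + 1)"
    using n by (intro mult_mono power_increasing) auto
  also have "real n ^ (N + 1) = real n powr real (N + 1)"
    using n by (subst powr_realpow) auto
  finally show "\<exists>m. c n = enat m \<and> real m \<le> real (k ^ N * l + 1) * real n powr real (N + 1)"
    using m(1) by blast
qed

theorem theorem5p1p7: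
  fixes M :: "('f::field_char_0, ('f, 'n::finite) der, 'f^'n^'n) lalg"
  assumes k: "CARD('n) \<ge> 2"
    and M: "M = mat_lalg"
  shows "\<not> polynomially_bounded (L_codim M) \<and>
    (\<forall>C :: ('f, ('f, 'n) der, 'b::ab_group_add) lalg.
       C \<in> L_variety M \<longrightarrow>
       L_variety C \<noteq> (L_variety M :: ('f, ('f, 'n) der, 'c::ab_group_add) lalg set) \<longrightarrow>
       polynomially_bounded (L_codim C))"
proof (intro conjI allI impI)
  show "\<not> polynomially_bounded (L_codim M)"
    unfolding M by (intro not_polynomially_bounded_exponential exponential_codim_mat k)
next
  fix C :: "('f, ('f, 'n) der, 'b) lalg"
  assume "C \<in> L_variety M"
    and neq: "L_variety C \<noteq> (L_variety M :: ('f, ('f, 'n) der, 'c::ab_group_add) lalg set)"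
  then have C: "is_L_algebra C" "L_identities M \<subseteq> L_identities C"
    by (auto simp: L_variety_def)
  then have "\<not> L_identities C \<subseteq> L_identities M"
    using neq by (auto simp: L_variety_def)
  then obtain f where "f \<in> L_identities C" "f \<notin> L_identities M"
    by blast
  from codim_bound[OF k C(1) M C(2) this] show "polynomially_bounded (L_codim C)"
    by (metis polynomially_boundedI)
qed

end
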